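(* Let $E$ be an arbitrary subset of $\mathbb{R}^n$ and let $f:E\to\mathbb{R}$, $G:E\to\mathbb{R}^n$ be two functions. Assume that the following conditions are satisfied: (i) $G$ is continuous and $f(x)\geq f(y)+\langle G(y),x-y\rangle$ for all $x,y\in E$. (ii) If $(x_k)_k\subset E$ is a sequence for which $\lim_{k\to\infty}|G(x_k)|=+\infty$, then $$\lim_{k\to\infty}\frac{\langle G(x_k),x_k\rangle-f(x_k)}{|G(x_k)|}=+\infty.$$ (iii) Let $P=P_Y:\mathbb{R}^n\to\mathbb{R}^n$ be the orthogonal projection onto $Y:=\mathrm{span}\{G(x)-G(y) : x,y\in E\}$. If $(x_k)_k,(z_k)_k$ are sequences in $E$ such that $(P(x_k))_k$ and $(G(z_k))_k$ are bounded and $$\lim_{k\to\infty}\left(f(x_k)-f(z_k)-\langle G(z_k),x_k-z_k\rangle\right)=0,$$ then $\lim_{k\to\infty}|G(x_k)-G(z_k)|=0$. Then there exists a convex function $F:\mathbb{R}^n\to\mathbb{R}$ of class $C^1$ such that $F(x)=f(x)$ and $\nabla F(x)=G(x)$ for all $x\in E$.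
   Context: $\langle\cdot,\cdot\rangle$ and $|\cdot|$ denote the Euclidean inner product and norm on $\mathbb{R}^n$. *)

theory Defs
  imports "HOL-Analysis.Analysis"
begin

text \<open>For a linear subspace the point below exists and is unique (see the lemma that follows);
  for other sets the definition is meaningless.\<close>

definition orth_proj :: "'a::euclidean_space set \<Rightarrow> 'a \<Rightarrow> 'a" where
  "orth_proj Y x = (THE y. y \<in> Y \<and> (\<forall>v\<in>Y. orthogonal (x - y) v))"

lemma orth_proj_ex1:
  fixes Y :: "'a::euclidean_space set"
  assumes "subspace Y"
  shows "\<exists>!y. y \<in> Y \<and> (\<forall>v\<in>Y. orthogonal (x - y) v)"
proof -
  have span: "span Y = Y"
    using assms by (simp add: span_eq_iff)
  obtain y z where "y \<in> span Y" "\<And>w. w \<in> span Y \<Longrightarrow> orthogonal z w" "x = y + z"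
    using orthogonal_subspace_decomp_exists by blast
  then have y: "y \<in> Y" "\<forall>v\<in>Y. orthogonal (x - y) v"
    by (auto simp: span)
  show ?thesis
  proof (rule ex1I[of _ y])
    fix y' assume y': "y' \<in> Y \<and> (\<forall>v\<in>Y. orthogonal (x - y') v)"
    then have "y - y' \<in> Y"
      using y assms by (simp add: subspace_diff)
    then have "(x - y') \<bullet> (y - y') = 0" "(x - y) \<bullet> (y - y') = 0"
      using y y' by (auto simp: orthogonal_def)
    then have "(y - y') \<bullet> (y - y') = 0"
      by (simp add: inner_diff_left)
    then show "y' = y" by simp
  qed (use y in blast)
qed

text \<open>\<open>GDERIV\<close> is Frechet differentiability with the derivative represented by its gradient.\<close>

definition class_C1 :: "('a::euclidean_space \<Rightarrow> real) \<Rightarrow> bool" where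
  "class_C1 F \<longleftrightarrow> (\<exists>D. (\<forall>x. GDERIV F x :> D x) \<and> continuous_on UNIV D)"

end

theory Submission
  imports Defs
begin

text \<open>
  Let \<open>M\<close> be the supremum of the affine functions \<open>f y + G y \<bullet> (p - y)\<close>. Condition (ii) makes it finite, so it is
  convex with \<open>M = f\<close> and \<open>G\<close> a subgradient on \<open>E\<close>, and condition (iii) says that \<open>M\<close> is differentiable at
  the points of \<open>E\<close> uniformly where \<open>P\<close> is bounded. If \<open>b\<close> is a suitable mean of finitely many gradients, then
  \<open>m p = M p - b \<bullet> p + (norm (p - P p))\<^sup>2\<close> is convex and coercive.
  On bounded parts of \<open>P ` E\<close> the excess of \<open>m\<close> over its tangents is dominated by a continuously
  differentiable function \<open>\<Phi>\<close> with \<open>\<Phi> 0 = 0\<close>; the infimum \<open>g\<close> of the functions tangent \<open>+ \<Phi>\<close> satisfies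
  \<open>m \<le> g\<close>, with equality on \<open>P ` E\<close>, and has second differences \<open>g (p + v) + g (p - v) - 2 * g p\<close> that are
  at most \<open>o(norm v)\<close>, locally uniformly. The convex envelope \<open>F\<close> of \<open>g\<close> inherits this bound, which forces a convex
  function to be \<open>C\<^sup>1\<close>. As \<open>m \<le> F \<le> g\<close>, the function \<open>F (P x) + b \<bullet> x\<close> is the extension sought.
\<close>

section \<open>One-sided second-difference bounds and C1 regularity\<close>

text \<open>Only an upper bound is asked, so that the property survives infima and convex envelopes;
  for a convex function second differences are nonnegative anyway.\<close>

definition locally_uniformly_smooth :: "('a::real_normed_vector \<Rightarrow> real) \<Rightarrow> bool" where
  "locally_uniformly_smooth g \<longleftrightarrow>
    (\<forall>R. \<forall>e>0. \<exists>d>0. \<forall>p v. norm p \<le> R \<longrightarrow> norm v \<le> d \<longrightarrow> g (p + v) + g (p - v) - 2 * g p \<le> e * norm v)"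

lemma locally_uniformly_smoothD:
  assumes "locally_uniformly_smooth g" "e > 0"
  obtains d where "d > 0"
    "\<And>p v. norm p \<le> R \<Longrightarrow> norm v \<le> d \<Longrightarrow> g (p + v) + g (p - v) - 2 * g p \<le> e * norm v"
  using assms unfolding locally_uniformly_smooth_def by blast

lemma convex_on_UNIV_subgradient_exists:
  fixes F :: "'a::euclidean_space \<Rightarrow> real"
  assumes F: "convex_on UNIV F"
  shows "\<exists>s. \<forall>y. F x + s \<bullet> (y - x) \<le> F y"
proof -
  \<comment> \<open>The epigraph is strict so that it misses the point \<open>(x, F x)\<close>,
    which a hyperplane then separates from it.\<close>
  let ?T = "{(y, t). F y < t}"
  have "convex ?T"
  proof (rule convexI)
    fix X Z :: "'a \<times> real" and u v :: real
    assume X: "X \<in> ?T" and Z: "Z \<in> ?T" and uv: "0 \<le> u" "0 \<le> v" "u + v = 1"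
    have "F (u *\<^sub>R fst X + v *\<^sub>R fst Z) \<le> u * F (fst X) + v * F (fst Z)"
      using F uv by (auto simp: convex_on_def)
    also have "\<dots> < u * snd X + v * snd Z"
    proof (cases "u = 0")
      case True
      then show ?thesis using Z uv by auto
    next
      case False
      then have "u * F (fst X) < u * snd X"
        using X uv by (auto simp: split_beta)
      moreover have "v * F (fst Z) \<le> v * snd Z"
        using Z uv by (auto simp: split_beta intro!: mult_left_mono)
      ultimately show ?thesis by linarith
    qed
    finally show "u *\<^sub>R X + v *\<^sub>R Z \<in> ?T"
      by (simp add: split_beta)
  qed
  moreover have "(x, F x + 1) \<in> ?T" by simp
  ultimately obtain a b where a: "a \<noteq> 0" "a \<bullet> (x, F x) \<le> b" "\<And>z. z \<in> ?T \<Longrightarrow> b \<le> a \<bullet> z"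
    using separating_hyperplane_sets[of "{(x, F x)}" ?T] by fastforce
  obtain p \<alpha> where p: "a = (p, \<alpha>)" by (cases a)
  have ineq: "p \<bullet> x + \<alpha> * F x \<le> p \<bullet> y + \<alpha> * t" if "F y < t" for y t
    using a(2) a(3)[of "(y, t)"] that by (simp add: p)
  have "0 \<le> \<alpha>" using ineq[of x "F x + 1"] by (simp add: algebra_simps)
  \<comment> \<open>A vertical hyperplane would bound the linear form \<open>p\<close> from below on
    the whole space, as \<open>F\<close> is finite everywhere.\<close>
  have "\<alpha> \<noteq> 0"
  proof
    assume "\<alpha> = 0"
    then have "p \<bullet> p \<le> 0" using ineq[of "x - p" "F (x - p) + 1"] by (simp add: algebra_simps)
    then have "p = 0" by (metis inner_ge_zero inner_eq_zero_iff order_antisym)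
    then show False using a(1) \<open>\<alpha> = 0\<close> p by (simp add: zero_prod_def)
  qed
  with \<open>0 \<le> \<alpha>\<close> have "0 < \<alpha>" by simp
  have "F x + (- (1 / \<alpha>) *\<^sub>R p) \<bullet> (y - x) \<le> F y" for y
  proof (rule field_le_epsilon)
    fix e :: real assume "0 < e"
    then have "p \<bullet> x + \<alpha> * F x \<le> p \<bullet> y + \<alpha> * (F y + e)" using ineq[of y "F y + e"] by simp
    then have "(p \<bullet> x + \<alpha> * F x) / \<alpha> \<le> (p \<bullet> y + \<alpha> * (F y + e)) / \<alpha>"
      using \<open>0 < \<alpha>\<close> by (simp add: divide_right_mono)
    then show "F x + (- (1 / \<alpha>) *\<^sub>R p) \<bullet> (y - x) \<le> F y + e"
      using \<open>0 < \<alpha>\<close> by (simp add: inner_diff_right add_divide_distrib diff_divide_distrib)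
  qed
  then show ?thesis by blast
qed

text \<open>The subgradient inequality at \<open>x - v\<close> turns the second-difference bound
  into an upper bound at \<open>x + v\<close> that matches the lower one up to
  \<open>e * norm v\<close>.\<close>

lemma GDERIV_subgradient:
  fixes F :: "'a::euclidean_space \<Rightarrow> real"
  assumes smooth: "locally_uniformly_smooth F" and s: "\<And>y. F x + s \<bullet> (y - x) \<le> F y"
  shows "GDERIV F x :> s"
  unfolding gderiv_def has_derivative_at_alt
proof (intro conjI allI impI)
  show "bounded_linear (\<lambda>h. h \<bullet> s)" by (rule bounded_linear_inner_left)
  fix e :: real assume "0 < e"
  obtain d where d: "d > 0" "\<And>p v. norm p \<le> norm x \<Longrightarrow> norm v \<le> d \<Longrightarrow> F (p + v) + F (p - v) - 2 * F p \<le> e * norm v"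
    using locally_uniformly_smoothD[OF smooth \<open>0 < e\<close>] by blast
  have "norm (F y - F x - (y - x) \<bullet> s) \<le> e * norm (y - x)" if "norm (y - x) < d" for y
    using d(2)[of x "y - x"] s[of y] s[of "x - (y - x)"] that
    by (simp add: inner_commute inner_diff_right abs_le_iff)
  then show "\<exists>d>0. \<forall>y. norm (y - x) < d \<longrightarrow> norm (F y - F x - (y - x) \<bullet> s) \<le> e * norm (y - x)"
    using d(1) by blast
qed

text \<open>Every subgradient is the gradient; its continuity follows by comparing the tangents at
  \<open>x\<close> and \<open>y\<close> at a common third point \<open>y + v\<close>.\<close>

lemma class_C1_convex_smooth:
  fixes F :: "'a::euclidean_space \<Rightarrow> real"
  assumes F: "convex_on UNIV F" and smooth: "locally_uniformly_smooth F"
  shows "class_C1 F"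
proof -
  obtain s where s: "\<And>x y. F x + s x \<bullet> (y - x) \<le> F y"
    using convex_on_UNIV_subgradient_exists[OF F] by metis
  have "isCont s x" for x
    unfolding continuous_at_eps_delta
  proof (intro allI impI)
    fix e :: real assume "0 < e"
    then have e3: "e / 3 > 0" by simp
    obtain d where d: "d > 0" "\<And>p v. norm p \<le> norm x + 1 \<Longrightarrow> norm v \<le> d \<Longrightarrow>
        F (p + v) + F (p - v) - 2 * F p \<le> e / 3 * norm v"
      using locally_uniformly_smoothD[OF smooth e3] by blast
    have up: "F (p + v) \<le> F p + s p \<bullet> v + e / 3 * norm v" if "norm p \<le> norm x + 1" "norm v \<le> d" for p v
      using d(2)[OF that] s[of p "p - v"] by (simp add: inner_minus_right)
    have "norm (s y - s x) < e" if y: "norm (y - x) < min d 1" for y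
    proof (cases "s y = s x")
      case False
      \<comment> \<open>A step of length \<open>d\<close> along the difference of slopes yields
        \<open>d * norm (s x - s y)\<close>, while all errors sum to at most
        \<open>2 / 3 * d * e\<close>.\<close>
      define v where "v = (d / norm (s x - s y)) *\<^sub>R (s x - s y)"
      have nv: "norm v = d" using False d(1) by (simp add: v_def)
      have inn: "(s x - s y) \<bullet> v = d * norm (s x - s y)"
        using False by (simp add: v_def power2_norm_eq_inner[symmetric] power2_eq_square)
      have "norm y \<le> norm x + 1"
        using y norm_triangle_sub[of y x] by simp
      then have "F (y + v) \<le> F y + s y \<bullet> v + e / 3 * d" using up[of y v] nv by simp
      moreover have "F x + s x \<bullet> (y + v - x) \<le> F (y + v)" by (rule s)
      moreover have "F y \<le> F x + s x \<bullet> (y - x) + e / 3 * norm (y - x)" using up[of x "y - x"] y by simp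
      ultimately have "(s x - s y) \<bullet> v \<le> e / 3 * norm (y - x) + e / 3 * d"
        by (simp add: algebra_simps)
      also have "\<dots> \<le> e / 3 * d + e / 3 * d" using y \<open>0 < e\<close> by (intro add_right_mono mult_left_mono) auto
      also have "\<dots> < d * e" using \<open>0 < e\<close> d(1) by simp
      finally show ?thesis using d(1) by (simp add: inn norm_minus_commute)
    qed (use \<open>0 < e\<close> in simp)
    then show "\<exists>d>0. \<forall>y. dist y x < d \<longrightarrow> dist (s y) (s x) < e"
      using d(1) by (intro exI[of _ "min d 1"]) (auto simp: dist_norm)
  qed
  then have "continuous_on UNIV s" by (simp add: continuous_at_imp_continuous_on)
  then show ?thesis unfolding class_C1_def using GDERIV_subgradient[OF smooth s] by blast
qed

text \<open>In the sum of the first-order expansions for \<open>v\<close> and \<open>- v\<close> the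
  linear terms cancel; the mean value inequality and uniform continuity of \<open>D\<close> on a
  compact ball make each remainder at most \<open>e / 2 * norm v\<close>.\<close>

lemma locally_uniformly_smooth_C1:
  fixes F :: "'a::euclidean_space \<Rightarrow> real"
  assumes D: "\<And>x. GDERIV F x :> D x" and cont: "continuous_on UNIV D"
  shows "locally_uniformly_smooth F"
  unfolding locally_uniformly_smooth_def
proof (intro allI impI)
  fix R e :: real assume "0 < e"
  have "uniformly_continuous_on (cball 0 (R + 1)) D"
    by (intro compact_uniformly_continuous compact_cball continuous_on_subset[OF cont]) simp
  then obtain d where d: "d > 0" "\<And>x y. norm x \<le> R + 1 \<Longrightarrow> norm y \<le> R + 1 \<Longrightarrow> dist y x < d \<Longrightarrow> dist (D y) (D x) < e / 2"
    unfolding uniformly_continuous_on_def using \<open>0 < e\<close> by (metis half_gt_zero mem_cball_0)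
  have *: "F (p + v) - F p - v \<bullet> D p \<le> e / 2 * norm v" if p: "norm p \<le> R" and v: "norm v < min d 1" for p v
  proof -
    let ?S = "cball p (norm v)"
    have "norm ((F (p + v) - (p + v) \<bullet> D p) - (F p - p \<bullet> D p)) \<le> e / 2 * norm ((p + v) - p)"
    proof (rule differentiable_bound[where S = ?S and f' = "\<lambda>y h. h \<bullet> D y - h \<bullet> D p"])
      fix y assume y: "y \<in> ?S"
      have "(F has_derivative (\<lambda>h. h \<bullet> D y)) (at y within ?S)"
        using D[of y] by (auto simp: gderiv_def intro: has_derivative_at_withinI)
      then show "((\<lambda>y. F y - y \<bullet> D p) has_derivative (\<lambda>h. h \<bullet> D y - h \<bullet> D p)) (at y within ?S)"
        by (auto intro!: derivative_eq_intros)
      have ny: "norm (y - p) \<le> norm v" using y by (simp add: dist_norm norm_minus_commute)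
      then have "norm y \<le> R + 1" using p v norm_triangle_sub[of y p] by simp
      then have "norm (D y - D p) \<le> e / 2" using d(2)[of p y] p ny v by (simp add: dist_norm)
      show "onorm (\<lambda>h. h \<bullet> D y - h \<bullet> D p) \<le> e / 2"
      proof (rule onorm_bound)
        show "0 \<le> e / 2" using \<open>0 < e\<close> by simp
        fix h
        have "norm (h \<bullet> D y - h \<bullet> D p) \<le> norm h * norm (D y - D p)"
          using Cauchy_Schwarz_ineq2[of h "D y - D p"] by (simp add: inner_diff_right)
        also have "\<dots> \<le> norm h * (e / 2)" using \<open>norm (D y - D p) \<le> e / 2\<close> by (intro mult_left_mono) auto
        finally show "norm (h \<bullet> D y - h \<bullet> D p) \<le> e / 2 * norm h" by (simp add: mult.commute)
      qed
    qed (auto simp: dist_norm)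
    then have "\<bar>(F (p + v) - (p + v) \<bullet> D p) - (F p - p \<bullet> D p)\<bar> \<le> e / 2 * norm v" by simp
    then show ?thesis unfolding inner_add_left by argo
  qed
  have "F (p + v) + F (p - v) - 2 * F p \<le> e * norm v" if "norm p \<le> R" "norm v \<le> min d 1 / 2" for p v
  proof -
    have "norm v < min d 1" using that(2) d(1) by (auto simp: min_def split: if_splits)
    then show ?thesis using *[OF that(1), of v] *[OF that(1), of "- v"] by simp
  qed
  then show "\<exists>d>0. \<forall>p v. norm p \<le> R \<longrightarrow> norm v \<le> d \<longrightarrow> F (p + v) + F (p - v) - 2 * F p \<le> e * norm v"
    using d(1) by (intro exI[of _ "min d 1 / 2"]) auto
qed

section \<open>Infima and convex envelopes of functions with bounded second differences\<close>

text \<open>The weights sum to 1, so one of them is at least the reciprocal of the number of nodes;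
  the other nodes, renormalised, form \<open>r\<close>.\<close>

lemma convex_hull_heavy_point:
  fixes S :: "'a::real_vector set"
  assumes "finite S" "card S \<le> N" "x \<in> convex hull S"
  obtains s r u where "s \<in> S" "r \<in> convex hull S" "u > 0" "u \<le> 1" "1 / real N \<le> u"
    "x = u *\<^sub>R s + (1 - u) *\<^sub>R r"
proof -
  obtain w where w: "\<And>s. s \<in> S \<Longrightarrow> 0 \<le> w s" "sum w S = 1" "(\<Sum>s\<in>S. w s *\<^sub>R s) = x"
    using assms by (auto simp: convex_hull_finite)
  have ne: "S \<noteq> {}" using w(2) by auto
  then have c: "card S > 0" using assms(1) by (simp add: card_gt_0_iff)
  have "\<exists>s\<in>S. 1 / real (card S) \<le> w s"
  proof (rule ccontr)
    assume "\<not> ?thesis"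
    then have "sum w S < (\<Sum>s\<in>S. 1 / real (card S))"
      using assms(1) ne by (intro sum_strict_mono) auto
    then show False using w(2) c by simp
  qed
  then obtain s where s: "s \<in> S" "1 / real (card S) \<le> w s" by blast
  have "1 / real N \<le> 1 / real (card S)" using c assms(2) by (simp add: frac_le)
  with s have N: "1 / real N \<le> w s" by simp
  have pos: "0 < w s" using s(2) c by (smt (verit) divide_pos_pos of_nat_0_less_iff)
  have sum1: "sum w (S - {s}) = 1 - w s" using w(2) s(1) assms(1) by (simp add: sum_diff1)
  have le1: "w s \<le> 1" using sum1 sum_nonneg[of "S - {s}" w] w(1) by fastforce
  have rest: "(\<Sum>t\<in>S - {s}. w t *\<^sub>R t) = x - w s *\<^sub>R s"
    using w(3) s(1) assms(1) by (simp add: sum_diff1)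
  show thesis
  proof (cases "w s = 1")
    \<comment> \<open>All weight sits on \<open>s\<close>: renormalising is impossible, but the
      factor of \<open>r\<close> vanishes and any point of the hull serves.\<close>
    case True
    then have "\<And>t. t \<in> S - {s} \<Longrightarrow> w t = 0"
      using sum1 w(1) assms(1) sum_nonneg_eq_0_iff[of "S - {s}" w] by auto
    then have "x - w s *\<^sub>R s = 0" using rest by (metis (no_types, lifting) scaleR_zero_left sum.neutral)
    then have "x = w s *\<^sub>R s + (1 - w s) *\<^sub>R s" using True by simp
    then show ?thesis using that[of s s "w s"] s pos le1 N by (simp add: hull_inc)
  next
    case False
    define r where "r = (\<Sum>t\<in>S - {s}. (w t / (1 - w s)) *\<^sub>R t)"
    have "r \<in> convex hull S"
      unfolding r_def
    proof (rule convex_sum)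
      show "(\<Sum>t\<in>S - {s}. w t / (1 - w s)) = 1" using sum1 False by (simp flip: sum_divide_distrib)
    qed (use assms(1) w(1) le1 in \<open>auto simp: hull_inc\<close>)
    moreover have "(1 - w s) *\<^sub>R r = x - w s *\<^sub>R s"
      unfolding r_def scaleR_sum_right using False by (simp add: rest)
    then have "x = w s *\<^sub>R s + (1 - w s) *\<^sub>R r" by simp
    ultimately show ?thesis using that s pos le1 N by blast
  qed
qed

text \<open>For an index \<open>i\<close> almost optimal at \<open>p\<close>, the function
  \<open>V i\<close> lies above the infimum at \<open>p + v\<close> and \<open>p - v\<close>, so its
  second difference bounds that of the infimum. The gap 1 outside \<open>J\<close> forces
  \<open>i\<close> into \<open>J\<close>, where the estimate is uniform.\<close>

lemma locally_uniformly_smooth_INF: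
  fixes V :: "'i \<Rightarrow> 'a::real_normed_vector \<Rightarrow> real"
  assumes I: "I \<noteq> {}" and bdd: "\<And>p. bdd_below ((\<lambda>i. V i p) ` I)"
    and unif: "\<And>R. \<exists>J. (\<forall>p. norm p \<le> R \<longrightarrow> (\<forall>i\<in>I - J. (INF i\<in>I. V i p) + 1 \<le> V i p)) \<and>
       (\<forall>e>0. \<exists>d>0. \<forall>i\<in>J. \<forall>p v. norm p \<le> R \<longrightarrow> norm v \<le> d \<longrightarrow>
          V i (p + v) + V i (p - v) - 2 * V i p \<le> e * norm v)"
  shows "locally_uniformly_smooth (\<lambda>p. INF i\<in>I. V i p)"
  unfolding locally_uniformly_smooth_def
proof (intro allI impI)
  fix R e :: real assume "0 < e"
  let ?g = "\<lambda>p. INF i\<in>I. V i p"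
  obtain J where J: "\<And>p i. norm p \<le> R \<Longrightarrow> i \<in> I - J \<Longrightarrow> ?g p + 1 \<le> V i p"
    "\<And>e. e > 0 \<Longrightarrow> \<exists>d>0. \<forall>i\<in>J. \<forall>p v. norm p \<le> R \<longrightarrow> norm v \<le> d \<longrightarrow>
          V i (p + v) + V i (p - v) - 2 * V i p \<le> e * norm v"
    using unif[of R] by blast
  obtain d where d: "d > 0" "\<And>i p v. i \<in> J \<Longrightarrow> norm p \<le> R \<Longrightarrow> norm v \<le> d \<Longrightarrow>
          V i (p + v) + V i (p - v) - 2 * V i p \<le> e * norm v"
    using J(2)[OF \<open>0 < e\<close>] by blast
  have "?g (p + v) + ?g (p - v) - 2 * ?g p \<le> e * norm v" if p: "norm p \<le> R" and v: "norm v \<le> d" for p v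
  proof (rule field_le_epsilon)
    fix t :: real assume "0 < t"
    \<comment> \<open>Below 1 to stay within the gap; the error occurs twice, hence
      \<open>2 * \<eta> \<le> t\<close>.\<close>
    define \<eta> where "\<eta> = min (t / 2) (1 / 2)"
    have \<eta>: "\<eta> > 0" "\<eta> < 1" "2 * \<eta> \<le> t" using \<open>0 < t\<close> by (auto simp: \<eta>_def)
    have "?g p < ?g p + \<eta>" using \<eta> by simp
    then obtain i where i: "i \<in> I" "V i p < ?g p + \<eta>"
      using cINF_less_iff[OF I bdd] by blast
    then have "i \<in> J" using J(1)[OF p, of i] \<eta> by force
    have "?g (p + v) \<le> V i (p + v)" "?g (p - v) \<le> V i (p - v)" using i bdd by (auto intro: cINF_lower)
    then show "?g (p + v) + ?g (p - v) - 2 * ?g p \<le> e * norm v + t"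
      using d(2)[OF \<open>i \<in> J\<close> p v] i(2) \<eta>(3) by linarith
  qed
  then show "\<exists>d>0. \<forall>p v. norm p \<le> R \<longrightarrow> norm v \<le> d \<longrightarrow> ?g (p + v) + ?g (p - v) - 2 * ?g p \<le> e * norm v"
    using d(1) by blast
qed

lemma convex_on_UNIV_bounded_ball:
  fixes F :: "'a::euclidean_space \<Rightarrow> real"
  assumes "convex_on UNIV F"
  obtains M where "M \<ge> 0" "\<And>x. norm x \<le> R \<Longrightarrow> \<bar>F x\<bar> \<le> M"
proof -
  have "continuous_on UNIV F" using assms by (intro convex_on_continuous) auto
  then have "continuous_on (cball 0 R) F" by (rule continuous_on_subset) simp
  then have "bounded (F ` cball 0 R)"
    by (intro compact_imp_bounded compact_continuous_image compact_cball)
  then obtain M where M: "\<And>y. y \<in> F ` cball 0 R \<Longrightarrow> norm y \<le> M"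
    unfolding bounded_iff by blast
  show thesis
  proof (rule that[of "max M 0"])
    show "\<bar>F x\<bar> \<le> max M 0" if "norm x \<le> R" for x
      using M[of "F x"] that by auto
  qed simp
qed

text \<open>The convex envelope of \<open>g\<close> inherits the upper bound on second differences: in an almost optimal
  representation of a point, the node of weight at least \<open>1 / (n + 2)\<close> stays bounded by coercivity, and a
  perturbation of the point can be absorbed by this node alone.\<close>

lemma smooth_convex_envelope:
  fixes m g :: "'a::euclidean_space \<Rightarrow> real"
  assumes m: "convex_on UNIV m" and le: "\<And>p. m p \<le> g p"
    and smooth: "locally_uniformly_smooth g"
    and coercive: "c > 0" "\<And>p. c * norm p - C \<le> m p"
  obtains F where "convex_on UNIV F" "\<And>p. m p \<le> F p" "\<And>p. F p \<le> g p" "locally_uniformly_smooth F"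
proof -
  let ?E = "{z. g (fst z) \<le> snd z}"
  let ?H = "convex hull ?E"
  let ?T = "\<lambda>x. {t. (x, t) \<in> ?H}"
  define F where "F x = Inf (?T x)" for x
  have "convex {z. m (fst z) \<le> snd z}"
    using m convex_epigraph[of UNIV m] by (simp add: epigraph_def)
  \<comment> \<open>The epigraph of \<open>m\<close> is convex and contains that of
    \<open>g\<close>, hence also its hull; this places \<open>F\<close> above
    \<open>m\<close>.\<close>
  then have "?H \<subseteq> {z. m (fst z) \<le> snd z}"
    by (intro hull_minimal) (auto intro: order_trans[OF le])
  then have Hm: "m x \<le> t" if "(x, t) \<in> ?H" for x t using that by auto
  have gH: "(x, g x) \<in> ?H" for x by (rule hull_inc) simp
  have bdd: "bdd_below (?T x)" for x by (rule bdd_belowI[of _ "m x"]) (use Hm in auto)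
  have FH: "F x \<le> t" if "(x, t) \<in> ?H" for x t
    unfolding F_def by (rule cInf_lower[OF _ bdd]) (use that in simp)
  have mF: "m x \<le> F x" for x
    unfolding F_def by (rule cInf_greatest) (use gH Hm in auto)
  have ex: "\<exists>t. (x, t) \<in> ?H \<and> t < F x + e" if "e > 0" for x e
    using cInf_lessD[of "?T x" "F x + e"] gH that unfolding F_def by auto
  have convF: "convex_on UNIV F"
  proof (rule convex_onI)
    fix u x y assume u: "0 < u" "u < (1::real)"
    show "F ((1 - u) *\<^sub>R x + u *\<^sub>R y) \<le> (1 - u) * F x + u * F y"
    proof (rule field_le_epsilon)
      fix e :: real assume "0 < e"
      obtain t s where ts: "(x, t) \<in> ?H" "t < F x + e" "(y, s) \<in> ?H" "s < F y + e"
        using ex[OF \<open>0 < e\<close>, of x] ex[OF \<open>0 < e\<close>, of y] by blast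
      have "(1 - u) *\<^sub>R (x, t) + u *\<^sub>R (y, s) \<in> ?H"
        using convex_convex_hull[of ?E] ts u by (intro convexD) auto
      then have "F ((1 - u) *\<^sub>R x + u *\<^sub>R y) \<le> (1 - u) * t + u * s"
        by (intro FH) simp
      also have "\<dots> \<le> (1 - u) * (F x + e) + u * (F y + e)"
        using ts u by (intro add_mono mult_left_mono) auto
      finally show "F ((1 - u) *\<^sub>R x + u *\<^sub>R y) \<le> (1 - u) * F x + u * F y + e"
        by (simp add: algebra_simps)
    qed
  qed simp
  have "locally_uniformly_smooth F"
    unfolding locally_uniformly_smooth_def
  proof (intro allI impI)
    fix R e :: real assume "0 < e"
    define C' where "C' = max C 0"
    have C': "- C' \<le> t" if "(x, t) \<in> ?H" for x t
    proof -
      have "0 \<le> c * norm x" using coercive(1) by simp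
      then show ?thesis using coercive(2)[of x] Hm[OF that] unfolding C'_def by linarith
    qed
    \<comment> \<open>The bound of Caratheodory's theorem in the product space, whose dimension is
      one more than that of \<open>'a\<close>.\<close>
    define N where "N = DIM('a \<times> real) + 1"
    obtain M where M: "M \<ge> 0" "\<And>x. norm x \<le> R \<Longrightarrow> \<bar>F x\<bar> \<le> M"
      using convex_on_UNIV_bounded_ball[OF convF] by blast
    \<comment> \<open>A node of weight at least \<open>1 / N\<close> has height at most
      \<open>N * (M + 1 + C')\<close>, since the rest contributes at least \<open>- C'\<close>;
      coercivity then bounds its position by \<open>R'\<close>.\<close>
    define R' where "R' = (C' + N * (M + 1 + C')) / c"
    obtain d where d: "d > 0" "\<And>p v. norm p \<le> R' \<Longrightarrow> norm v \<le> d \<Longrightarrow> g (p + v) + g (p - v) - 2 * g p \<le> e / 2 * norm v"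
      using locally_uniformly_smoothD[OF smooth half_gt_zero[OF \<open>0 < e\<close>]] by blast
    have "F (x + v) + F (x - v) - 2 * F x \<le> e * norm v" if x: "norm x \<le> R" and v: "norm v \<le> d / N" for x v
    proof (cases "v = 0")
      case False
      \<comment> \<open>The cap 1 enters the choice of \<open>R'\<close>; the other one makes the
        loss \<open>2 * \<eta>\<close> at most half of the allowed error.\<close>
      define \<eta> where "\<eta> = min 1 (e * norm v / 4)"
      have \<eta>: "0 < \<eta>" "\<eta> \<le> 1" "\<eta> \<le> e * norm v / 4" using False \<open>0 < e\<close> by (auto simp: \<eta>_def)
      obtain t where t: "(x, t) \<in> ?H" "t < F x + \<eta>" using ex[OF \<eta>(1)] by blast
      obtain S where S: "finite S" "S \<subseteq> ?E" "card S \<le> N" "(x, t) \<in> convex hull S"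
        using t(1) unfolding caratheodory[of ?E] N_def by blast
      obtain s r u where sru: "s \<in> S" "r \<in> convex hull S" "u > 0" "u \<le> 1" "1 / real N \<le> u"
          "(x, t) = u *\<^sub>R s + (1 - u) *\<^sub>R r"
        using convex_hull_heavy_point[OF S(1,3,4)] by metis
      obtain p0 t0 r1 r2 where eqs: "s = (p0, t0)" "r = (r1, r2)" by (cases s, cases r) auto
      have rH: "(r1, r2) \<in> ?H" using sru(2) hull_mono[OF S(2), of convex] eqs by auto
      have g0: "g p0 \<le> t0" using sru(1) S(2) eqs by auto
      have xt: "x = u *\<^sub>R p0 + (1 - u) *\<^sub>R r1" "t = u * t0 + (1 - u) * r2"
        using sru(6) eqs by auto
      have "- C' \<le> r2" using C'[OF rH] .
      then have "(1 - u) * (- C') \<le> (1 - u) * r2" using sru by (intro mult_left_mono) auto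
      moreover have "0 \<le> u * C'" using sru by (simp add: C'_def)
      moreover have "t \<le> M + 1" using t(2) \<eta> M(2)[OF x] by linarith
      ultimately have "u * t0 \<le> M + 1 + C'" using xt(2) by (simp add: algebra_simps)
      have "t0 \<le> N * (M + 1 + C')"
      proof (cases "t0 \<le> 0")
        case True
        then show ?thesis using M(1) by (intro order_trans[OF True] mult_nonneg_nonneg) (auto simp: C'_def)
      next
        case False
        then have "1 / real N * t0 \<le> u * t0" using sru(5) by (intro mult_right_mono) auto
        then have "1 / real N * t0 \<le> M + 1 + C'" using \<open>u * t0 \<le> M + 1 + C'\<close> by linarith
        then show ?thesis by (simp add: field_simps N_def)
      qed
      then have "c * norm p0 \<le> C' + N * (M + 1 + C')"
        using coercive(2)[of p0] le[of p0] g0 unfolding C'_def by linarith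
      then have p0: "norm p0 \<le> R'" using coercive(1) by (simp add: R'_def field_simps)
      \<comment> \<open>Moving the heavy node alone by \<open>w\<close> moves the whole combination
        by \<open>v\<close>; as \<open>1 / u \<le> N\<close>, the restriction
        \<open>norm v \<le> d / N\<close> keeps \<open>norm w\<close> below
        \<open>d\<close>.\<close>
      define w where "w = (1 / u) *\<^sub>R v"
      have uw: "u *\<^sub>R w = v" using sru(3) by (simp add: w_def)
      have "1 / u \<le> N" using sru(3,5) by (simp add: field_simps N_def)
      then have "norm w \<le> N * norm v" using sru(3) mult_right_mono[of "1 / u" N "norm v"] by (simp add: w_def)
      also have "\<dots> \<le> d" using v by (simp add: field_simps N_def)
      finally have w: "norm w \<le> d" .
      have unw: "u * norm w = norm v" using sru(3) by (simp add: w_def)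
      have F1: "F (x + q) \<le> u * g (p0 + z) + (1 - u) * r2" if "u *\<^sub>R z = q" for q z
      proof -
        have "u *\<^sub>R (p0 + z, g (p0 + z)) + (1 - u) *\<^sub>R (r1, r2) \<in> ?H"
          using convex_convex_hull[of ?E] rH gH sru by (intro convexD) auto
        moreover have "u *\<^sub>R (p0 + z, g (p0 + z)) + (1 - u) *\<^sub>R (r1, r2) = (x + q, u * g (p0 + z) + (1 - u) * r2)"
          using that xt by (simp add: algebra_simps)
        ultimately show ?thesis by (intro FH) simp
      qed
      have "F (x + v) + F (x - v) \<le> u * (g (p0 + w) + g (p0 - w)) + 2 * ((1 - u) * r2)"
        using F1[of w v] F1[of "- w" "- v"] uw by (simp add: distrib_left)
      also have "\<dots> \<le> u * (2 * t0 + e / 2 * norm w) + 2 * ((1 - u) * r2)"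
        using d(2)[OF p0 w] g0 sru(3) by (intro add_right_mono mult_left_mono) auto
      also have "\<dots> = 2 * t + e / 2 * (u * norm w)"
        using xt(2) by (simp add: algebra_simps)
      also have "\<dots> \<le> 2 * F x + e * norm v"
        using t(2) \<eta>(3) unw by simp
      finally show ?thesis by simp
    qed simp
    then show "\<exists>d>0. \<forall>p v. norm p \<le> R \<longrightarrow> norm v \<le> d \<longrightarrow> F (p + v) + F (p - v) - 2 * F p \<le> e * norm v"
      using d(1) by (intro exI[of _ "d / N"]) (auto simp: N_def)
  qed
  then show thesis using that convF mF FH[OF gH] by blast
qed

section \<open>Smooth majorants for the excess over tangents\<close>

lemma locally_uniformly_smooth_add:
  assumes "locally_uniformly_smooth f" "locally_uniformly_smooth g"
  shows "locally_uniformly_smooth (\<lambda>p. f p + g p)"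
  unfolding locally_uniformly_smooth_def
proof (intro allI impI)
  fix R e :: real assume "0 < e"
  obtain d1 where d1: "d1 > 0" "\<And>p v. norm p \<le> R \<Longrightarrow> norm v \<le> d1 \<Longrightarrow> f (p + v) + f (p - v) - 2 * f p \<le> e / 2 * norm v"
    using locally_uniformly_smoothD[OF assms(1) half_gt_zero[OF \<open>0 < e\<close>]] by blast
  obtain d2 where d2: "d2 > 0" "\<And>p v. norm p \<le> R \<Longrightarrow> norm v \<le> d2 \<Longrightarrow> g (p + v) + g (p - v) - 2 * g p \<le> e / 2 * norm v"
    using locally_uniformly_smoothD[OF assms(2) half_gt_zero[OF \<open>0 < e\<close>]] by blast
  have "f (p + v) + g (p + v) + (f (p - v) + g (p - v)) - 2 * (f p + g p) \<le> e * norm v"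
    if "norm p \<le> R" "norm v \<le> min d1 d2" for p v
    using d1(2)[of p v] d2(2)[of p v] that by simp
  then show "\<exists>d>0. \<forall>p v. norm p \<le> R \<longrightarrow> norm v \<le> d \<longrightarrow>
      f (p + v) + g (p + v) + (f (p - v) + g (p - v)) - 2 * (f p + g p) \<le> e * norm v"
    using d1(1) d2(1) by (intro exI[of _ "min d1 d2"]) auto
qed

lemma locally_uniformly_smooth_norm_sq:
  fixes A :: real
  assumes "A \<ge> 0"
  shows "locally_uniformly_smooth (\<lambda>p::'a::real_inner. A * (norm p)\<^sup>2)"
  unfolding locally_uniformly_smooth_def
proof (intro allI impI)
  fix R e :: real assume "0 < e"
  have "A * (norm (p + v))\<^sup>2 + A * (norm (p - v))\<^sup>2 - 2 * (A * (norm p)\<^sup>2) \<le> e * norm v"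
    if "norm v \<le> e / (2 * A + 1)" for p v :: 'a
  proof -
    have "A * (norm (p + v))\<^sup>2 + A * (norm (p - v))\<^sup>2 - 2 * (A * (norm p)\<^sup>2) = 2 * A * norm v * norm v"
      by (simp add: power2_norm_eq_inner algebra_simps inner_commute flip: power2_eq_square)
    also have "\<dots> \<le> e * norm v"
    proof (rule mult_right_mono)
      have "(2 * A + 1) * norm v \<le> e" using that assms by (simp add: field_simps)
      then show "2 * A * norm v \<le> e" by (simp add: algebra_simps) (smt (verit) norm_ge_zero)
    qed simp
    finally show ?thesis .
  qed
  then show "\<exists>d>0. \<forall>p v::'a. norm p \<le> R \<longrightarrow> norm v \<le> d \<longrightarrow>
      A * (norm (p + v))\<^sup>2 + A * (norm (p - v))\<^sup>2 - 2 * (A * (norm p)\<^sup>2) \<le> e * norm v"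
    using assms \<open>0 < e\<close> by (intro exI[of _ "e / (2 * A + 1)"]) auto
qed

text \<open>The majorant is the integral of the nondecreasing function \<open>\<beta> s / s\<close> over \<open>[0, 2 * norm v]\<close>:
  it is continuously differentiable although \<open>\<beta>\<close> need not be.\<close>

lemma smooth_radial_majorant:
  fixes \<beta> :: "real \<Rightarrow> real"
  assumes conv: "convex_on UNIV \<beta>" and nonneg: "\<And>t. 0 \<le> \<beta> t" and zero: "\<beta> 0 = 0"
    and small: "\<And>e. e > 0 \<Longrightarrow> \<exists>d>0. \<forall>t. 0 \<le> t \<and> t \<le> d \<longrightarrow> \<beta> t \<le> e * t"
  obtains \<Phi> :: "'a::euclidean_space \<Rightarrow> real"
    where "locally_uniformly_smooth \<Phi>" "continuous_on UNIV \<Phi>" "\<Phi> 0 = 0" "\<And>v. \<beta> (norm v) \<le> \<Phi> v"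
proof -
  \<comment> \<open>Division by zero gives \<open>H 0 = 0\<close>, which is the limit of
    \<open>\<beta> s / s\<close> from the right and makes \<open>H\<close> continuous on the closed
    half-line.\<close>
  define H where "H s = \<beta> s / s" for s
  have H0: "0 \<le> H s" if "0 \<le> s" for s using that nonneg by (simp add: H_def)
  \<comment> \<open>\<open>H\<close> is the slope of the chord from the origin, nondecreasing
    because \<open>\<beta>\<close> is convex and vanishes at 0.\<close>
  have Hmono: "H s \<le> H t" if "0 < s" "s \<le> t" for s t
  proof -
    have "\<beta> ((1 - s / t) *\<^sub>R 0 + (s / t) *\<^sub>R t) \<le> (1 - s / t) * \<beta> 0 + (s / t) * \<beta> t"
      using that by (intro convex_onD[OF conv]) auto
    then show ?thesis using that by (simp add: H_def zero field_simps)
  qed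
  have Hsmall: "\<exists>d>0. \<forall>s. 0 \<le> s \<and> s \<le> d \<longrightarrow> H s \<le> e" if "e > 0" for e
  proof -
    obtain d where "d > 0" "\<forall>t. 0 \<le> t \<and> t \<le> d \<longrightarrow> \<beta> t \<le> e * t" using small[OF \<open>e > 0\<close>] by blast
    then show ?thesis using that by (intro exI[of _ d]) (auto simp: H_def divide_simps)
  qed
  have c\<beta>: "isCont \<beta> s" for s
    using convex_on_continuous[OF open_UNIV conv] by (simp add: continuous_on_eq_continuous_at)
  have Hcont: "isCont H s" if "0 < s" for s
    unfolding H_def using that c\<beta> by (intro continuous_intros) auto
  have Hcon: "continuous_on {0..} H"
    unfolding continuous_on_eq_continuous_within
  proof
    fix s :: real assume s: "s \<in> {0..}"
    show "continuous (at s within {0..}) H"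
    proof (cases "s = 0")
      case True
      show ?thesis
        unfolding continuous_within_eps_delta
      proof (intro allI impI)
        fix e :: real assume "0 < e"
        then obtain d where d: "d > 0" "\<forall>s. 0 \<le> s \<and> s \<le> d \<longrightarrow> H s \<le> e / 2"
          using Hsmall[of "e / 2"] by auto
        have "dist (H y) (H s) < e" if "y \<in> {0..}" "dist y s < d" for y
        proof -
          have "H y \<le> e / 2" using d that True by (auto simp: dist_norm)
          then show ?thesis using H0[of y] that True \<open>0 < e\<close> by (simp add: dist_norm H_def[of 0])
        qed
        with d(1) show "\<exists>d>0. \<forall>y\<in>{0..}. dist y s < d \<longrightarrow> dist (H y) (H s) < e"
          by (intro exI[of _ d] conjI ballI impI)
      qed
    next
      case False
      then have "isCont H s" using Hcont[of s] s by auto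
      then show ?thesis by (rule continuous_at_imp_continuous_within)
    qed
  qed
  define J where "J x = integral {0..x} H" for x
  have Hint: "H integrable_on {x..y}" if "0 \<le> x" for x y
    using that by (intro integrable_continuous_interval continuous_on_subset[OF Hcon]) auto
  have Jpos: "0 \<le> J x" if "0 \<le> x" for x
    unfolding J_def using that by (intro integral_nonneg Hint H0) auto
  have JD: "(J has_real_derivative H x) (at x)" if "0 < x" for x
  proof -
    have "((\<lambda>x. integral {0..x} H) has_real_derivative H x) (at x within {0..x + 1})"
      using that by (intro integral_has_real_derivative continuous_on_subset[OF Hcon]) auto
    moreover have "at x within {0..x + 1} = at x" using that by (intro at_within_interior) auto
    ultimately show ?thesis unfolding J_def by simp
  qed
  have Jsmall: "J x \<le> e * x" if "0 \<le> x" "\<And>s. 0 \<le> s \<Longrightarrow> s \<le> x \<Longrightarrow> H s \<le> e" for x e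
  proof -
    have "integral {0..x} H \<le> integral {0..x} (\<lambda>_. e)"
      using that by (intro integral_le Hint) auto
    then show ?thesis using that(1) by (simp add: J_def mult.commute)
  qed
  \<comment> \<open>On \<open>[t, 2 * t]\<close> the integrand is at least \<open>H t\<close>, so
    this interval alone contributes \<open>t * H t = \<beta> t\<close>.\<close>
  have Jlarge: "\<beta> t \<le> J (2 * t)" if "0 \<le> t" for t
  proof (cases "t = 0")
    case False
    then have "0 < t" using that by simp
    have "t * H t = integral {t..2 * t} (\<lambda>_. H t)" using that by simp
    also have "\<dots> \<le> integral {t..2 * t} H"
      using \<open>0 < t\<close> by (intro integral_le Hint Hmono) auto
    also have "\<dots> \<le> J t + integral {t..2 * t} H" using Jpos[OF that] by simp
    also have "\<dots> = J (2 * t)"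
      unfolding J_def using that by (intro Henstock_Kurzweil_Integration.integral_combine Hint) auto
    finally show ?thesis using \<open>0 < t\<close> by (simp add: H_def)
  qed (simp add: zero Jpos)
  define \<Phi> :: "'a \<Rightarrow> real" where "\<Phi> v = J (2 * norm v)" for v
  define D :: "'a \<Rightarrow> 'a" where "D v = (2 * H (2 * norm v)) *\<^sub>R sgn v" for v
  have GD: "GDERIV \<Phi> v :> D v" for v
  proof (cases "v = 0")
    case False
    have "((\<lambda>t. J (2 * t)) has_real_derivative H (2 * norm v) * 2) (at (norm v))"
      using False by (intro DERIV_chain2[of J] JD) (auto intro!: derivative_eq_intros)
    then show ?thesis unfolding \<Phi>_def D_def using GDERIV_DERIV_compose[OF GDERIV_norm[OF False]]
      by (simp add: mult.commute)
  next
    case True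
    show ?thesis unfolding gderiv_def has_derivative_at_alt
    proof (intro conjI allI impI)
      show "bounded_linear (\<lambda>h. h \<bullet> D v)" by (rule bounded_linear_inner_left)
      fix e :: real assume "0 < e"
      then obtain d where d: "d > 0" "\<forall>s. 0 \<le> s \<and> s \<le> d \<longrightarrow> H s \<le> e / 2"
        using Hsmall[of "e / 2"] by auto
      have "norm (\<Phi> y - \<Phi> v - (y - v) \<bullet> D v) \<le> e * norm (y - v)" if "norm (y - v) < d / 2" for y
        using that True d(2) Jsmall[of "2 * norm y" "e / 2"] Jpos[of "2 * norm y"]
        by (simp add: \<Phi>_def D_def J_def[of 0])
      then show "\<exists>d>0. \<forall>y. norm (y - v) < d \<longrightarrow> norm (\<Phi> y - \<Phi> v - (y - v) \<bullet> D v) \<le> e * norm (y - v)"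
        using d(1) by (intro exI[of _ "d / 2"]) auto
    qed
  qed
  have "isCont D v" for v
  proof (cases "v = 0")
    case False
    have "isCont (\<lambda>v::'a. 2 * norm v) v" by (intro continuous_intros)
    moreover have "isCont H (2 * norm v)" using False by (intro Hcont) simp
    ultimately have "isCont (\<lambda>v. H (2 * norm v)) v" by (rule isCont_o2)
    moreover have "isCont sgn v" using False isCont_sgn[OF continuous_ident, of v] by simp
    ultimately show ?thesis unfolding D_def by (intro isCont_scaleR isCont_mult) auto
  next
    case True
    show ?thesis unfolding continuous_at_eps_delta
    proof (intro allI impI)
      fix e :: real assume "0 < e"
      then obtain d where d: "d > 0" "\<forall>s. 0 \<le> s \<and> s \<le> d \<longrightarrow> H s \<le> e / 4"
        using Hsmall[of "e / 4"] by auto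
      have "dist (D y) (D v) < e" if "dist y v < d / 2" for y
      proof -
        have "H (2 * norm y) \<le> e / 4" using d that True by (auto simp: dist_norm)
        then show ?thesis using True \<open>0 < e\<close> H0[of "2 * norm y"] by (auto simp: D_def dist_norm norm_sgn)
      qed
      then show "\<exists>d>0. \<forall>y. dist y v < d \<longrightarrow> dist (D y) (D v) < e"
        using d(1) by (intro exI[of _ "d / 2"]) auto
    qed
  qed
  then have "locally_uniformly_smooth \<Phi>"
    by (intro locally_uniformly_smooth_C1[OF GD] continuous_at_imp_continuous_on) auto
  moreover have "continuous_on UNIV \<Phi>"
    using has_derivative_continuous[OF GD[unfolded gderiv_def]]
    by (intro continuous_at_imp_continuous_on) simp
  ultimately show thesis using that[of \<Phi>] Jlarge by (simp add: \<Phi>_def J_def[of 0])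
qed

text \<open>\<open>\<beta>\<close> is the worst excess over the tangents among all indices and
  directions: a supremum of convex functions, finite because points and slopes are bounded, and
  \<open>o(t)\<close> by the uniformity assumption, so the radial majorant applies. The quadratic
  term is added to it as a growth condition.\<close>

lemma uniform_smooth_majorant:
  fixes m :: "'a::euclidean_space \<Rightarrow> real"
  assumes m: "convex_on UNIV m" and A: "A \<ge> 0"
    and bounds: "\<And>i. i \<in> I \<Longrightarrow> norm (a i) \<le> R" "\<And>i. i \<in> I \<Longrightarrow> norm (s i) \<le> L"
    and sub: "\<And>i p. i \<in> I \<Longrightarrow> m (a i) + s i \<bullet> (p - a i) \<le> m p"
    and unif: "\<And>e. e > 0 \<Longrightarrow> \<exists>d>0. \<forall>i\<in>I. \<forall>v. norm v \<le> d \<longrightarrow> m (a i + v) \<le> m (a i) + s i \<bullet> v + e * norm v"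
  shows "\<exists>\<Phi>. locally_uniformly_smooth \<Phi> \<and> continuous_on UNIV \<Phi> \<and> \<Phi> 0 = 0 \<and> (\<forall>v. A * (norm v)\<^sup>2 \<le> \<Phi> v) \<and>
    (\<forall>i\<in>I. \<forall>v. m (a i + v) \<le> m (a i) + s i \<bullet> v + \<Phi> v)"
proof (cases "I = {}")
  case True
  then show ?thesis using locally_uniformly_smooth_norm_sq[OF A]
    by (intro exI[of _ "\<lambda>v. A * (norm v)\<^sup>2"]) (auto intro!: continuous_intros)
next
  case False
  define E where "E i v = m (a i + v) - m (a i) - s i \<bullet> v" for i v
  define X where "X = I \<times> cball (0::'a) 1"
  define \<beta> where "\<beta> t = (SUP x\<in>X. E (fst x) (t *\<^sub>R snd x))" for t :: real
  have X: "X \<noteq> {}" using False by (simp add: X_def)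
  have Econv: "E i ((1 - u) *\<^sub>R x + u *\<^sub>R y) \<le> (1 - u) * E i x + u * E i y" if "0 \<le> u" "u \<le> 1" for i x y and u :: real
  proof -
    have "a i + ((1 - u) *\<^sub>R x + u *\<^sub>R y) = (1 - u) *\<^sub>R (a i + x) + u *\<^sub>R (a i + y)"
      by (simp add: algebra_simps)
    then have "m (a i + ((1 - u) *\<^sub>R x + u *\<^sub>R y)) \<le> (1 - u) * m (a i + x) + u * m (a i + y)"
      using that by (simp add: convex_onD[OF m])
    then show ?thesis by (simp add: E_def algebra_simps)
  qed
  have bdd: "bdd_above ((\<lambda>x. E (fst x) (t *\<^sub>R snd x)) ` X)" for t
  proof -
    obtain M where M: "M \<ge> 0" "\<And>x. norm x \<le> R + \<bar>t\<bar> \<Longrightarrow> \<bar>m x\<bar> \<le> M"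
      using convex_on_UNIV_bounded_ball[OF m] by blast
    have "E i (t *\<^sub>R w) \<le> M + M + L * \<bar>t\<bar>" if "i \<in> I" "norm w \<le> 1" for i w
    proof -
      have tw: "norm (t *\<^sub>R w) \<le> \<bar>t\<bar>" using that(2) by (simp add: mult_left_le)
      have "norm (a i + t *\<^sub>R w) \<le> R + \<bar>t\<bar>"
        using norm_triangle_le bounds(1)[OF that(1)] tw by (meson add_mono)
      then have 1: "\<bar>m (a i + t *\<^sub>R w)\<bar> \<le> M" by (rule M(2))
      have 2: "\<bar>m (a i)\<bar> \<le> M" using bounds(1)[OF that(1)] by (intro M(2)) simp
      have "\<bar>s i \<bullet> (t *\<^sub>R w)\<bar> \<le> norm (s i) * norm (t *\<^sub>R w)" by (rule Cauchy_Schwarz_ineq2)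
      also have "\<dots> \<le> L * \<bar>t\<bar>"
        by (intro mult_mono bounds(2)[OF that(1)] tw order_trans[OF norm_ge_zero bounds(2)[OF that(1)]]) simp
      finally show ?thesis using 1 2 unfolding E_def by linarith
    qed
    then show ?thesis by (intro bdd_aboveI2[of _ _ "M + M + L * \<bar>t\<bar>"]) (auto simp: X_def)
  qed
  have up: "E i (t *\<^sub>R w) \<le> \<beta> t" if "i \<in> I" "norm w \<le> 1" for i w t
    unfolding \<beta>_def using that by (intro cSUP_upper2[OF bdd, of "(i, w)"]) (auto simp: X_def)
  have least: "\<beta> t \<le> B" if "\<And>i w. i \<in> I \<Longrightarrow> norm w \<le> 1 \<Longrightarrow> E i (t *\<^sub>R w) \<le> B" for t B
    unfolding \<beta>_def using that X by (intro cSUP_least) (auto simp: X_def)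
  have E0: "E i 0 = 0" for i by (simp add: E_def)
  have nonneg: "0 \<le> \<beta> t" for t
    using False up[of _ 0 t] E0 by fastforce
  have zero: "\<beta> 0 = 0" using nonneg[of 0] least[of 0 0] E0 by (simp add: order_antisym)
  have conv: "convex_on UNIV \<beta>"
  proof (rule convex_onI)
    fix u x y :: real assume u: "0 < u" "u < 1"
    show "\<beta> ((1 - u) *\<^sub>R x + u *\<^sub>R y) \<le> (1 - u) * \<beta> x + u * \<beta> y"
    proof (rule least)
      fix i and w :: 'a assume iw: "i \<in> I" "norm w \<le> 1"
      have "E i (((1 - u) *\<^sub>R x + u *\<^sub>R y) *\<^sub>R w) = E i ((1 - u) *\<^sub>R (x *\<^sub>R w) + u *\<^sub>R (y *\<^sub>R w))"
        by (simp add: scaleR_add_left)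
      also have "\<dots> \<le> (1 - u) * E i (x *\<^sub>R w) + u * E i (y *\<^sub>R w)" using u by (intro Econv) auto
      also have "\<dots> \<le> (1 - u) * \<beta> x + u * \<beta> y" using u up[OF iw] by (intro add_mono mult_left_mono) auto
      finally show "E i (((1 - u) *\<^sub>R x + u *\<^sub>R y) *\<^sub>R w) \<le> (1 - u) * \<beta> x + u * \<beta> y" .
    qed
  qed simp
  have small: "\<exists>d>0. \<forall>t. 0 \<le> t \<and> t \<le> d \<longrightarrow> \<beta> t \<le> e * t" if "e > 0" for e
  proof -
    obtain d where d: "d > 0" "\<And>i v. i \<in> I \<Longrightarrow> norm v \<le> d \<Longrightarrow> m (a i + v) \<le> m (a i) + s i \<bullet> v + e * norm v"
      using unif[OF \<open>e > 0\<close>] by blast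
    have "\<beta> t \<le> e * t" if t: "0 \<le> t" "t \<le> d" for t
    proof (rule least)
      fix i and w :: 'a assume iw: "i \<in> I" "norm w \<le> 1"
      have tw: "norm (t *\<^sub>R w) \<le> t" using iw t by (simp add: mult_left_le)
      then have "E i (t *\<^sub>R w) \<le> e * norm (t *\<^sub>R w)"
        using d(2)[OF iw(1), of "t *\<^sub>R w"] t(2) by (simp add: E_def)
      also have "\<dots> \<le> e * t" using tw \<open>e > 0\<close> by (intro mult_left_mono) auto
      finally show "E i (t *\<^sub>R w) \<le> e * t" .
    qed
    then show ?thesis using d(1) by blast
  qed
  obtain \<Phi> :: "'a \<Rightarrow> real" where \<Phi>: "locally_uniformly_smooth \<Phi>" "continuous_on UNIV \<Phi>"
      "\<Phi> 0 = 0" "\<And>v. \<beta> (norm v) \<le> \<Phi> v"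
    using smooth_radial_majorant[OF conv nonneg zero small] by blast
  have EP: "E i v \<le> \<Phi> v" if "i \<in> I" for i v
    using up[OF that, of "sgn v" "norm v"] \<Phi>(4)[of v]
    by (cases "v = 0") (simp_all add: norm_sgn sgn_div_norm E0)
  have EPhi: "m (a i + v) \<le> m (a i) + s i \<bullet> v + \<Phi> v" if "i \<in> I" for i v
    using EP[OF that, of v] by (simp add: E_def)
  have pos: "0 \<le> \<Phi> v" for v using nonneg \<Phi>(4) order_trans by blast
  show ?thesis
  proof (intro exI[of _ "\<lambda>v. \<Phi> v + A * (norm v)\<^sup>2"] conjI ballI allI)
    show "locally_uniformly_smooth (\<lambda>v. \<Phi> v + A * (norm v)\<^sup>2)"
      by (intro locally_uniformly_smooth_add \<Phi>(1) locally_uniformly_smooth_norm_sq A)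
    show "continuous_on UNIV (\<lambda>v. \<Phi> v + A * (norm v)\<^sup>2)" by (intro continuous_intros \<Phi>(2))
    show "A * (norm v)\<^sup>2 \<le> \<Phi> v + A * (norm v)\<^sup>2" for v using pos by simp
    show "m (a i + v) \<le> m (a i) + s i \<bullet> v + (\<Phi> v + A * (norm v)\<^sup>2)" if "i \<in> I" for i v
    proof -
      have "0 \<le> A * (norm v)\<^sup>2" using A by simp
      then show ?thesis using EPhi[OF that, of v] by linarith
    qed
  qed (simp add: \<Phi>(3))
qed

section \<open>Extension from prescribed tangents in the coercive case\<close>

text \<open>Indexing by \<open>I\<close> admits several indices with the same point: in the
  application the index is \<open>x\<close> in \<open>E\<close> and the point is \<open>P x\<close>,
  and \<open>P\<close> need not be injective on \<open>E\<close>.\<close>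

theorem convex_C1_extension:
  fixes m :: "'a::euclidean_space \<Rightarrow> real" and a s :: "'i \<Rightarrow> 'a"
  assumes I: "I \<noteq> {}" and m: "convex_on UNIV m"
    and coercive: "c > 0" "\<And>p. c * norm p - C \<le> m p"
    and sub: "\<And>i p. i \<in> I \<Longrightarrow> m (a i) + s i \<bullet> (p - a i) \<le> m p"
    and unif: "\<And>R e. e > 0 \<Longrightarrow> \<exists>d>0. \<forall>i\<in>I. \<forall>v. norm (a i) \<le> R \<longrightarrow> norm v \<le> d \<longrightarrow>
      m (a i + v) \<le> m (a i) + s i \<bullet> v + e * norm v"
  obtains F where "convex_on UNIV F" "class_C1 F"
    "\<And>i. i \<in> I \<Longrightarrow> F (a i) = m (a i)" "\<And>i. i \<in> I \<Longrightarrow> GDERIV F (a i) :> s i"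
proof -
  \<comment> \<open>A common majorant is obtained only for bounded sets of points, so one is taken
    for each integer radius \<open>k\<close>; the margin 1 in the radius of \<open>M k\<close>
    leaves room for a unit step.\<close>
  define K where "K k = {i \<in> I. norm (a i) \<le> real k}" for k
  obtain M where M: "\<And>k. M k \<ge> 0" "\<And>k x. norm x \<le> real k + 1 \<Longrightarrow> \<bar>m x\<bar> \<le> M k"
  proof -
    have "\<exists>M\<ge>0. \<forall>x. norm x \<le> real k + 1 \<longrightarrow> \<bar>m x\<bar> \<le> M" for k
      using convex_on_UNIV_bounded_ball[OF m, of "real k + 1"] by blast
    then show thesis using that by metis
  qed
  \<comment> \<open>The subgradient inequality is tested one unit away from \<open>a i\<close> in
    the direction of its slope.\<close>
  have sbound: "norm (s i) \<le> 2 * M k" if "i \<in> K k" for i k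
  proof -
    have i: "i \<in> I" "norm (a i) \<le> real k" using that by (auto simp: K_def)
    have "norm (s i) = s i \<bullet> sgn (s i)"
      by (cases "s i = 0") (simp_all add: sgn_div_norm power2_eq_square flip: power2_norm_eq_inner)
    moreover have "norm (a i + sgn (s i)) \<le> real k + 1"
      using i(2) by (intro norm_triangle_le) (auto simp: norm_sgn)
    ultimately show ?thesis
      using sub[OF i(1), of "a i + sgn (s i)"] M(2)[of "a i + sgn (s i)" k] M(2)[of "a i" k] i(2) by auto
  qed
  \<comment> \<open>The quadratic lower bound keeps the tangents at far away points above the infimum (fact \<open>far\<close> below).\<close>
  have "\<exists>\<Phi>. locally_uniformly_smooth \<Phi> \<and> continuous_on UNIV \<Phi> \<and> \<Phi> 0 = 0 \<and>
      (\<forall>v. (3 * M k + real k) * (norm v)\<^sup>2 \<le> \<Phi> v) \<and>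
      (\<forall>i\<in>K k. \<forall>v. m (a i + v) \<le> m (a i) + s i \<bullet> v + \<Phi> v)" for k
  proof (rule uniform_smooth_majorant[OF m _ _ sbound])
    show "\<exists>d>0. \<forall>i\<in>K k. \<forall>v. norm v \<le> d \<longrightarrow> m (a i + v) \<le> m (a i) + s i \<bullet> v + e * norm v" if "e > 0" for e
      using unif[OF that, of k] by (fastforce simp: K_def)
  qed (use M(1) sub in \<open>auto simp: K_def\<close>)
  then obtain \<Phi> where \<Phi>: "\<And>k. locally_uniformly_smooth (\<Phi> k)" "\<And>k. continuous_on UNIV (\<Phi> k)" "\<And>k. \<Phi> k 0 = 0"
      "\<And>k v. (3 * M k + real k) * (norm v)\<^sup>2 \<le> \<Phi> k v"
      "\<And>k i v. i \<in> K k \<Longrightarrow> m (a i + v) \<le> m (a i) + s i \<bullet> v + \<Phi> k v"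
    by metis
  define l where "l i = nat \<lceil>norm (a i)\<rceil>" for i
  have l: "norm (a i) \<le> real (l i)" for i unfolding l_def by (simp add: real_nat_ceiling_ge)
  have iK: "i \<in> K (l i)" if "i \<in> I" for i using that l by (simp add: K_def)
  define V where "V i p = m (a i) + s i \<bullet> (p - a i) + \<Phi> (l i) (p - a i)" for i p
  have mV: "m p \<le> V i p" if "i \<in> I" for i p
    using \<Phi>(5)[OF iK[OF that], of "p - a i"] by (simp add: V_def)
  have bdd: "bdd_below ((\<lambda>i. V i p) ` I)" for p by (intro bdd_belowI2[of _ "m p"] mV)
  let ?g = "\<lambda>p. INF i\<in>I. V i p"
  have far: "norm (a i) \<le> V i p" if i: "i \<in> I" and p: "norm p + 1 \<le> norm (a i)" for i p
  proof -
    let ?r = "norm (p - a i)"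
    have r: "1 \<le> ?r" using p norm_triangle_ineq2[of "a i" p] by (simp add: norm_minus_commute)
    have "\<bar>s i \<bullet> (p - a i)\<bar> \<le> norm (s i) * ?r" by (rule Cauchy_Schwarz_ineq2)
    also have "\<dots> \<le> 2 * M (l i) * ?r" using sbound[OF iK[OF i]] by (intro mult_right_mono) auto
    finally have 1: "- (2 * M (l i) * ?r) \<le> s i \<bullet> (p - a i)" by linarith
    have 2: "- M (l i) \<le> m (a i)" using M(2)[of "a i" "l i"] l[of i] by linarith
    have "(3 * M (l i) + real (l i)) * ?r \<le> (3 * M (l i) + real (l i)) * ?r\<^sup>2"
      using r M(1)[of "l i"] self_le_power[of ?r 2] by (intro mult_left_mono) auto
    also have "\<dots> \<le> \<Phi> (l i) (p - a i)" by (rule \<Phi>(4))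
    finally have "- M (l i) + (M (l i) + real (l i)) * ?r \<le> V i p"
      using 1 2 unfolding V_def by (simp add: algebra_simps)
    moreover have "(M (l i) + real (l i)) * 1 \<le> (M (l i) + real (l i)) * ?r"
      using r M(1)[of "l i"] by (intro mult_left_mono) auto
    ultimately show ?thesis using l[of i] unfolding mult_1_right by linarith
  qed
  have smooth: "locally_uniformly_smooth ?g"
  proof (rule locally_uniformly_smooth_INF[OF I bdd])
    fix R :: real
    obtain i0 where i0: "i0 \<in> I" using I by blast
    have "continuous_on UNIV (V i0)"
      unfolding V_def by (intro continuous_intros continuous_on_compose2[OF \<Phi>(2)]) auto
    then have "continuous_on (cball 0 R) (V i0)" by (rule continuous_on_subset) simp
    then have "bounded (V i0 ` cball 0 R)"
      by (intro compact_imp_bounded compact_continuous_image compact_cball)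
    then obtain U where U: "\<And>p. norm p \<le> R \<Longrightarrow> norm (V i0 p) \<le> U"
      unfolding bounded_iff by fastforce
    \<comment> \<open>Beyond \<open>\<rho>\<close> the fact \<open>far\<close> puts
      \<open>V i p\<close> above \<open>U + 1\<close>, and the competitor \<open>i0\<close> keeps
      the infimum at most \<open>U\<close>.\<close>
    define \<rho> where "\<rho> = max (R + 1) (U + 1)"
    let ?J = "{i \<in> I. norm (a i) \<le> \<rho>}"
    have "?g p + 1 \<le> V i p" if p: "norm p \<le> R" and i: "i \<in> I - ?J" for p i
    proof -
      have "?g p \<le> V i0 p" using i0 bdd by (intro cINF_lower) auto
      moreover have "R + 1 < norm (a i)" "U + 1 < norm (a i)" using i by (auto simp: \<rho>_def)
      ultimately show ?thesis using U[OF p] far[of i p] i p by auto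
    qed
    moreover have "\<exists>d>0. \<forall>i\<in>?J. \<forall>p v. norm p \<le> R \<longrightarrow> norm v \<le> d \<longrightarrow>
          V i (p + v) + V i (p - v) - 2 * V i p \<le> e * norm v" if "e > 0" for e
    proof -
      have "\<exists>d>0. \<forall>p v. norm p \<le> R + \<rho> \<longrightarrow> norm v \<le> d \<longrightarrow>
          \<Phi> k (p + v) + \<Phi> k (p - v) - 2 * \<Phi> k p \<le> e * norm v" for k
        using \<Phi>(1)[of k] \<open>e > 0\<close> unfolding locally_uniformly_smooth_def by blast
      then obtain d where d: "\<And>k. d k > 0" "\<And>k p v. norm p \<le> R + \<rho> \<Longrightarrow> norm v \<le> d k \<Longrightarrow>
          \<Phi> k (p + v) + \<Phi> k (p - v) - 2 * \<Phi> k p \<le> e * norm v"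
        by metis
      \<comment> \<open>Indices in \<open>?J\<close> involve only the majorants up to
        \<open>nat \<lceil>\<rho>\<rceil>\<close>, so a minimum of finitely many \<open>d k\<close>
        suffices.\<close>
      define d0 where "d0 = Min (d ` {..nat \<lceil>\<rho>\<rceil>})"
      have "d0 > 0" unfolding d0_def using d(1) by auto
      moreover have "V i (p + v) + V i (p - v) - 2 * V i p \<le> e * norm v"
        if i: "i \<in> ?J" and p: "norm p \<le> R" and v: "norm v \<le> d0" for i p v
      proof -
        have "l i \<le> nat \<lceil>\<rho>\<rceil>" unfolding l_def by (rule nat_mono[OF ceiling_mono]) (use i in simp)
        then have "d0 \<le> d (l i)" unfolding d0_def by (intro Min_le) auto
        moreover have "norm (p - a i) \<le> R + \<rho>"
          using norm_triangle_ineq4[of p "a i"] p i by auto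
        ultimately have "\<Phi> (l i) (p - a i + v) + \<Phi> (l i) (p - a i - v) - 2 * \<Phi> (l i) (p - a i) \<le> e * norm v"
          using v by (intro d(2)) auto
        then show ?thesis by (simp add: V_def inner_diff_right inner_add_right algebra_simps)
      qed
      ultimately show ?thesis by blast
    qed
    ultimately show "\<exists>J. (\<forall>p. norm p \<le> R \<longrightarrow> (\<forall>i\<in>I - J. ?g p + 1 \<le> V i p)) \<and>
       (\<forall>e>0. \<exists>d>0. \<forall>i\<in>J. \<forall>p v. norm p \<le> R \<longrightarrow> norm v \<le> d \<longrightarrow>
          V i (p + v) + V i (p - v) - 2 * V i p \<le> e * norm v)"
      by (intro exI[of _ ?J]) blast
  qed
  have "m p \<le> ?g p" for p using I mV by (intro cINF_greatest) auto
  then obtain F where F: "convex_on UNIV F" "\<And>p. m p \<le> F p" "\<And>p. F p \<le> ?g p" "locally_uniformly_smooth F"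
    using smooth_convex_envelope[OF m _ smooth coercive] by blast
  \<comment> \<open>Since \<open>\<Phi> k 0 = 0\<close>, the function \<open>V i\<close> touches
    \<open>m\<close> at \<open>a i\<close> and the bounds \<open>m \<le> F \<le> ?g\<close> collapse
    there; the slope \<open>s i\<close> is then also a subgradient of \<open>F\<close>.\<close>
  have eq: "F (a i) = m (a i)" if "i \<in> I" for i
  proof -
    have "?g (a i) \<le> V i (a i)" using that bdd by (intro cINF_lower) auto
    then show ?thesis using F(2,3)[of "a i"] by (simp add: V_def \<Phi>(3))
  qed
  moreover have "GDERIV F (a i) :> s i" if "i \<in> I" for i
    using sub[OF that] eq[OF that] F(2) by (intro GDERIV_subgradient[OF F(4)]) (auto intro: order_trans)
  ultimately show thesis using that F(1) class_C1_convex_smooth[OF F(1,4)] by blast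
qed

section \<open>Orthogonal projections\<close>

lemma
  fixes Y :: "'a::euclidean_space set"
  assumes "subspace Y"
  shows orth_proj_mem: "orth_proj Y x \<in> Y"
    and orth_proj_orthogonal: "v \<in> Y \<Longrightarrow> (x - orth_proj Y x) \<bullet> v = 0"
  using theI'[OF orth_proj_ex1[OF assms, of x]] by (auto simp: orth_proj_def orthogonal_def)

lemma orth_proj_eqI:
  fixes Y :: "'a::euclidean_space set"
  assumes "subspace Y" "y \<in> Y" "\<And>v. v \<in> Y \<Longrightarrow> (x - y) \<bullet> v = 0"
  shows "orth_proj Y x = y"
  unfolding orth_proj_def using orth_proj_ex1[OF assms(1), of x] assms(2,3)
  by (intro the1_equality) (auto simp: orthogonal_def)

lemma linear_orth_proj:
  fixes Y :: "'a::euclidean_space set"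
  assumes Y: "subspace Y"
  shows "linear (orth_proj Y)"
proof (rule linearI)
  note [simp] = orth_proj_mem[OF Y]
  note o = orth_proj_orthogonal[OF Y]
  show "orth_proj Y (x + y) = orth_proj Y x + orth_proj Y y" for x y
  proof (rule orth_proj_eqI[OF Y])
    show "(x + y - (orth_proj Y x + orth_proj Y y)) \<bullet> v = 0" if "v \<in> Y" for v
      using o[OF that, of x] o[OF that, of y] by (simp add: algebra_simps)
  qed (simp add: subspace_add[OF Y])
  show "orth_proj Y (c *\<^sub>R x) = c *\<^sub>R orth_proj Y x" for c x
  proof (rule orth_proj_eqI[OF Y])
    show "(c *\<^sub>R x - c *\<^sub>R orth_proj Y x) \<bullet> v = 0" if "v \<in> Y" for v
      using o[OF that, of x] by (simp add: algebra_simps)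
  qed (simp add: subspace_scale[OF Y])
qed

lemma inner_orth_proj:
  fixes Y :: "'a::euclidean_space set"
  assumes Y: "subspace Y"
  shows "orth_proj Y x \<bullet> y = x \<bullet> orth_proj Y y"
  using orth_proj_orthogonal[OF Y orth_proj_mem[OF Y], of x y]
    orth_proj_orthogonal[OF Y orth_proj_mem[OF Y], of y x]
  by (simp add: inner_diff_left inner_diff_right inner_commute)

lemma norm_orth_proj_le:
  fixes Y :: "'a::euclidean_space set"
  assumes Y: "subspace Y"
  shows "norm (orth_proj Y x) \<le> norm x" "norm (x - orth_proj Y x) \<le> norm x"
proof -
  let ?P = "orth_proj Y x"
  have "orthogonal ?P (x - ?P)"
    using orth_proj_orthogonal[OF Y orth_proj_mem[OF Y], of x x] by (simp add: orthogonal_def inner_commute)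
  then have eq: "(norm x)\<^sup>2 = (norm ?P)\<^sup>2 + (norm (x - ?P))\<^sup>2"
    using norm_add_Pythagorean[of ?P "x - ?P"] by simp
  show "norm ?P \<le> norm x" by (rule power2_le_imp_le) (simp_all add: eq)
  show "norm (x - ?P) \<le> norm x" by (rule power2_le_imp_le) (simp_all add: eq)
qed

text \<open>The chain rule applies the adjoint of the projection to \<open>D\<close>, and the
  projection is self-adjoint.\<close>

lemma GDERIV_compose_orth_proj:
  fixes Y :: "'a::euclidean_space set"
  assumes Y: "subspace Y" and F: "GDERIV F (orth_proj Y x) :> D"
  shows "GDERIV (\<lambda>x. F (orth_proj Y x)) x :> orth_proj Y D"
proof -
  have "(orth_proj Y has_derivative orth_proj Y) (at x)"
    using linear_orth_proj[OF Y] by (intro bounded_linear_imp_has_derivative linear_conv_bounded_linear[THEN iffD1])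
  from diff_chain_at[OF this, of F "\<lambda>h. h \<bullet> D"] F show ?thesis
    unfolding gderiv_def by (simp add: o_def inner_orth_proj[OF Y])
qed

lemma convex_on_norm_sq_linear:
  fixes A :: "'a::real_vector \<Rightarrow> 'b::real_inner"
  assumes A: "linear A"
  shows "convex_on UNIV (\<lambda>p. (norm (A p))\<^sup>2)"
proof (rule convex_onI)
  fix u :: real and x y assume u: "0 < u" "u < 1"
  have "(1 - u) * (norm X)\<^sup>2 + u * (norm Y)\<^sup>2 - (norm ((1 - u) *\<^sub>R X + u *\<^sub>R Y))\<^sup>2
      = u * (1 - u) * (norm (X - Y))\<^sup>2" for X Y :: 'b
    by (simp add: power2_norm_eq_inner algebra_simps inner_commute)
  from this[of "A x" "A y"]
  have "(1 - u) * (norm (A x))\<^sup>2 + u * (norm (A y))\<^sup>2 - (norm (A ((1 - u) *\<^sub>R x + u *\<^sub>R y)))\<^sup>2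
      = u * (1 - u) * (norm (A x - A y))\<^sup>2"
    by (simp only: linear_add[OF A] linear_scale[OF A])
  also have "\<dots> \<ge> 0" using u by simp
  finally show "(norm (A ((1 - u) *\<^sub>R x + u *\<^sub>R y)))\<^sup>2 \<le> (1 - u) * (norm (A x))\<^sup>2 + u * (norm (A y))\<^sup>2" by simp
qed simp

section \<open>The supremum of the tangents: finiteness, uniform differentiability,
  coercivity\<close>

definition tangent_sup :: "'a set \<Rightarrow> ('a \<Rightarrow> real) \<Rightarrow> ('a \<Rightarrow> 'a) \<Rightarrow> 'a::euclidean_space \<Rightarrow> real" where
  "tangent_sup E f G p = (SUP y\<in>E. f y + G y \<bullet> (p - y))"

text \<open>If the tangents were unbounded at \<open>p\<close>, those at \<open>y k\<close> with
  values above \<open>k\<close> would still stay below \<open>f (y 0)\<close> at \<open>y 0\<close>,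
  so their slopes blow up. Condition (ii) then makes their values at \<open>p\<close> eventually
  negative.\<close>

lemma bdd_above_tangents:
  fixes E :: "'a::euclidean_space set"
  assumes sub: "\<And>x y. x \<in> E \<Longrightarrow> y \<in> E \<Longrightarrow> f x \<ge> f y + G y \<bullet> (x - y)"
    and lim: "\<And>x :: nat \<Rightarrow> 'a. (\<And>k. x k \<in> E) \<Longrightarrow>
           filterlim (\<lambda>k. norm (G (x k))) at_top sequentially \<Longrightarrow>
           filterlim (\<lambda>k. (G (x k) \<bullet> x k - f (x k)) / norm (G (x k))) at_top sequentially"
  shows "bdd_above ((\<lambda>y. f y + G y \<bullet> (p - y)) ` E)"
proof (rule ccontr)
  assume "\<not> ?thesis"
  then have "\<exists>y\<in>E. real k < f y + G y \<bullet> (p - y)" for k :: nat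
    unfolding bdd_above_def by (metis (no_types, lifting) image_iff not_le)
  then obtain y where y: "\<And>k::nat. y k \<in> E" "\<And>k. real k < f (y k) + G (y k) \<bullet> (p - y k)" by metis
  define B where "B = norm (p - y 0) + 1"
  have B: "B > 0" by (simp add: B_def add_nonneg_pos)
  have low: "(real k - f (y 0)) / B \<le> norm (G (y k))" for k
  proof -
    have "G (y k) \<bullet> (p - y 0) \<le> norm (G (y k)) * norm (p - y 0)" by (rule norm_cauchy_schwarz)
    then have "G (y k) \<bullet> (p - y 0) \<le> norm (G (y k)) * B" by (simp add: B_def distrib_left add_increasing2)
    moreover have "G (y k) \<bullet> (p - y k) = G (y k) \<bullet> (p - y 0) + G (y k) \<bullet> (y 0 - y k)"
      by (simp add: inner_diff_right)
    ultimately have "real k - f (y 0) \<le> norm (G (y k)) * B"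
      using y(2)[of k] sub[OF y(1)[of 0] y(1)[of k]] by linarith
    then show ?thesis using B by (simp add: divide_le_eq)
  qed
  have "filterlim (\<lambda>k. inverse B * (- f (y 0) + real k)) at_top sequentially"
    using B by (intro filterlim_tendsto_pos_mult_at_top[OF tendsto_const]
        filterlim_tendsto_add_at_top[OF tendsto_const] filterlim_real_sequentially) simp
  then have G: "filterlim (\<lambda>k. norm (G (y k))) at_top sequentially"
    by (rule filterlim_at_top_mono) (use low in \<open>simp add: divide_inverse mult.commute\<close>)
  \<comment> \<open>With the quotient at least \<open>norm p + 1\<close>, the value at
    \<open>p\<close> is at most \<open>- norm (G (y k))\<close>, against the lower bound
    \<open>k\<close>.\<close>
  have "eventually (\<lambda>k. norm p + 1 \<le> (G (y k) \<bullet> y k - f (y k)) / norm (G (y k))) sequentially"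
    using lim[OF y(1) G] unfolding filterlim_at_top by blast
  moreover have "eventually (\<lambda>k. 1 \<le> norm (G (y k))) sequentially"
    using G unfolding filterlim_at_top by blast
  ultimately have "eventually (\<lambda>k. norm p + 1 \<le> (G (y k) \<bullet> y k - f (y k)) / norm (G (y k)) \<and> 1 \<le> norm (G (y k))) sequentially"
    by (rule eventually_conj)
  then obtain k where k: "norm p + 1 \<le> (G (y k) \<bullet> y k - f (y k)) / norm (G (y k))" "1 \<le> norm (G (y k))"
    unfolding eventually_sequentially by blast
  then have "(norm p + 1) * norm (G (y k)) \<le> G (y k) \<bullet> y k - f (y k)" by (simp add: le_divide_eq split: if_splits)
  moreover have "G (y k) \<bullet> p \<le> norm (G (y k)) * norm p" by (rule norm_cauchy_schwarz)
  ultimately show False using y(2)[of k] k(2) by (simp add: algebra_simps)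
qed

context
  fixes E :: "'a::euclidean_space set" and f :: "'a \<Rightarrow> real" and G :: "'a \<Rightarrow> 'a"
  assumes E: "E \<noteq> {}"
    and sub: "\<And>x y. x \<in> E \<Longrightarrow> y \<in> E \<Longrightarrow> f x \<ge> f y + G y \<bullet> (x - y)"
    and bdd: "\<And>p. bdd_above ((\<lambda>y. f y + G y \<bullet> (p - y)) ` E)"
begin

private abbreviation "M \<equiv> tangent_sup E f G"

lemma tangent_sup_upper: "y \<in> E \<Longrightarrow> f y + G y \<bullet> (p - y) \<le> M p"
  unfolding tangent_sup_def by (intro cSUP_upper bdd)

lemma tangent_sup_least: "(\<And>y. y \<in> E \<Longrightarrow> f y + G y \<bullet> (p - y) \<le> B) \<Longrightarrow> M p \<le> B"
  unfolding tangent_sup_def using E by (intro cSUP_least)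

lemma tangent_sup_eq: "x \<in> E \<Longrightarrow> M x = f x"
  using tangent_sup_upper[of x x] by (intro antisym tangent_sup_least sub) simp_all

lemma convex_on_tangent_sup: "convex_on UNIV M"
proof (rule convex_onI)
  fix u :: real and x y assume u: "0 < u" "u < 1"
  show "M ((1 - u) *\<^sub>R x + u *\<^sub>R y) \<le> (1 - u) * M x + u * M y"
  proof (rule tangent_sup_least)
    fix z assume z: "z \<in> E"
    have "f z + G z \<bullet> ((1 - u) *\<^sub>R x + u *\<^sub>R y - z) =
        (1 - u) * (f z + G z \<bullet> (x - z)) + u * (f z + G z \<bullet> (y - z))"
      by (simp add: algebra_simps inner_diff_right inner_add_right)
    also have "\<dots> \<le> (1 - u) * M x + u * M y"
      using u z by (intro add_mono mult_left_mono tangent_sup_upper) auto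
    finally show "f z + G z \<bullet> ((1 - u) *\<^sub>R x + u *\<^sub>R y - z) \<le> (1 - u) * M x + u * M y" .
  qed
qed simp

text \<open>After subtracting \<open>b\<close> all slopes lie in \<open>Y\<close>, so no tangent
  sees a displacement orthogonal to \<open>Y\<close>.\<close>

lemma tangent_sup_tilted_cong:
  assumes Y: "subspace Y" and b: "\<And>y. y \<in> E \<Longrightarrow> G y - b \<in> Y"
    and eq: "orth_proj Y p = orth_proj Y q"
  shows "M p - b \<bullet> p = M q - b \<bullet> q"
proof -
  have *: "M p - b \<bullet> p \<le> M q - b \<bullet> q" if eq: "orth_proj Y p = orth_proj Y q" for p q
  proof -
    have "M p \<le> M q + b \<bullet> (p - q)"
    proof (rule tangent_sup_least)
      fix y assume y: "y \<in> E"
      have "(p - q) \<bullet> (G y - b) = 0"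
        using orth_proj_orthogonal[OF Y b[OF y], of p] orth_proj_orthogonal[OF Y b[OF y], of q] eq
        by (simp add: algebra_simps)
      then have "G y \<bullet> (p - y) = G y \<bullet> (q - y) + b \<bullet> (p - q)"
        by (simp add: algebra_simps inner_commute)
      then show "f y + G y \<bullet> (p - y) \<le> M q + b \<bullet> (p - q)" using tangent_sup_upper[OF y, of q] by simp
    qed
    then show ?thesis by (simp add: inner_diff_right)
  qed
  show ?thesis using *[OF eq] *[OF eq[symmetric]] by simp
qed

text \<open>Failure gives points \<open>x k\<close>, steps \<open>v k\<close> tending to 0 and
  tangents at \<open>z k\<close> exceeding the bound at \<open>x k + v k\<close>. The slopes at
  \<open>x k\<close> and \<open>z k\<close> stay bounded, so the gap \<open>?\<delta> k\<close>
  between \<open>f (x k)\<close> and the tangent at \<open>z k\<close> tends to 0; condition (iii)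
  makes the slopes merge, whereas the failure needs them to differ by more than
  \<open>e\<close>.\<close>

lemma tangent_sup_uniformly_differentiable:
  assumes Y: "subspace Y" and GY: "\<And>x y. x \<in> E \<Longrightarrow> y \<in> E \<Longrightarrow> G x - G y \<in> Y"
    and lim: "\<And>x z :: nat \<Rightarrow> 'a.
           (\<And>k. x k \<in> E) \<Longrightarrow> (\<And>k. z k \<in> E) \<Longrightarrow>
           bounded (range (\<lambda>k. orth_proj Y (x k))) \<Longrightarrow>
           bounded (range (\<lambda>k. G (z k))) \<Longrightarrow>
           (\<lambda>k. f (x k) - f (z k) - G (z k) \<bullet> (x k - z k)) \<longlonglongrightarrow> 0 \<Longrightarrow>
           (\<lambda>k. norm (G (x k) - G (z k))) \<longlonglongrightarrow> 0"
    and e: "e > 0"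
  shows "\<exists>d>0. \<forall>x\<in>E. \<forall>v. norm (orth_proj Y x) \<le> R \<longrightarrow> norm v \<le> d \<longrightarrow> M (x + v) \<le> f x + G x \<bullet> v + e * norm v"
proof (rule ccontr)
  let ?P = "orth_proj Y"
  assume neg: "\<not> ?thesis"
  have "\<exists>x v. x \<in> E \<and> norm (?P x) \<le> R \<and> norm v \<le> 1 / (real k + 1) \<and> f x + G x \<bullet> v + e * norm v < M (x + v)" for k
  proof -
    have "1 / (real k + 1) > 0" by simp
    then show ?thesis using neg by (meson not_le)
  qed
  then obtain x v where x: "\<And>k. x k \<in> E" "\<And>k. norm (?P (x k)) \<le> R" and v: "\<And>k. norm (v k) \<le> 1 / (real k + 1)"
    and xv: "\<And>k. f (x k) + G (x k) \<bullet> v k + e * norm (v k) < M (x k + v k)" by metis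
  have "\<exists>z\<in>E. f (x k) + G (x k) \<bullet> v k + e * norm (v k) < f z + G z \<bullet> (x k + v k - z)" for k
    using xv[of k] unfolding tangent_sup_def by (subst (asm) less_cSUP_iff[OF E bdd])
  then obtain z where z: "\<And>k. z k \<in> E"
    and zv: "\<And>k. f (x k) + G (x k) \<bullet> v k + e * norm (v k) < f (z k) + G (z k) \<bullet> (x k + v k - z k)" by metis
  obtain y0 where y0: "y0 \<in> E" using E by blast
  define b where "b = G y0"
  obtain B where B: "B \<ge> 0" "\<And>p. norm p \<le> R + 2 \<Longrightarrow> \<bar>M p\<bar> \<le> B"
    using convex_on_UNIV_bounded_ball[OF convex_on_tangent_sup] by blast
  define B' where "B' = B + norm b * (R + 2)"
  \<comment> \<open>The points \<open>x k\<close> may be unbounded; only their projections are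
    bounded, and the tilted supremum sees nothing else.\<close>
  have W: "\<bar>M p - b \<bullet> p\<bar> \<le> B'" if "norm (?P p) \<le> R + 2" for p
  proof -
    have "?P (?P p) = ?P p" by (rule orth_proj_eqI[OF Y orth_proj_mem[OF Y]]) simp
    then have "M p - b \<bullet> p = M (?P p) - b \<bullet> ?P p"
      using GY y0 by (intro tangent_sup_tilted_cong[OF Y]) (auto simp: b_def)
    moreover have "\<bar>b \<bullet> ?P p\<bar> \<le> norm b * (R + 2)"
      using Cauchy_Schwarz_ineq2[of b "?P p"] mult_left_mono[OF that norm_ge_zero[of b]] by linarith
    ultimately show ?thesis using B(2)[OF that] by (simp add: B'_def)
  qed
  \<comment> \<open>Radius 2 covers a step \<open>v k\<close> followed by a unit step, hence the
    margin in \<open>R + 2\<close>.\<close>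
  have diff: "M (x k + w) - f (x k) \<le> 2 * B' + 2 * norm b" if w: "norm w \<le> 2" for k w
  proof -
    have "?P (x k + w) = ?P (x k) + ?P w" by (rule linear_add[OF linear_orth_proj[OF Y]])
    moreover have "norm (?P w) \<le> 2" using norm_orth_proj_le(1)[OF Y, of w] w by linarith
    ultimately have "norm (?P (x k + w)) \<le> R + 2" using x(2)[of k] by (simp add: norm_triangle_le add_mono)
    then have "\<bar>M (x k + w) - b \<bullet> (x k + w)\<bar> \<le> B'" by (rule W)
    moreover have "\<bar>M (x k) - b \<bullet> x k\<bar> \<le> B'" using x(2)[of k] by (intro W) simp
    moreover have "b \<bullet> w \<le> 2 * norm b"
      using norm_cauchy_schwarz[of b w] mult_left_mono[OF w norm_ge_zero[of b]] by linarith
    ultimately show ?thesis using tangent_sup_eq[OF x(1)[of k]] by (simp add: inner_add_right)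
  qed
  have v1: "norm (v k) \<le> 1" for k using v[of k] by (rule order_trans) simp
  define L where "L = 2 * B' + 2 * norm b"
  have sgn: "g \<bullet> sgn g = norm g" for g :: 'a
    by (cases "g = 0") (simp_all add: sgn_div_norm power2_eq_square flip: power2_norm_eq_inner)
  have nsgn: "norm (sgn g) \<le> 1" for g :: 'a by (simp add: norm_sgn)
  have Gx: "norm (G (x k)) \<le> L" for k
    using tangent_sup_upper[OF x(1)[of k], of "x k + sgn (G (x k))"] diff[of "sgn (G (x k))" k] nsgn[of "G (x k)"]
    by (simp add: sgn L_def)
  have Gxv: "\<bar>G (x k) \<bullet> v k\<bar> \<le> L * norm (v k)" for k
    using Cauchy_Schwarz_ineq2[of "G (x k)" "v k"] mult_right_mono[OF Gx[of k] norm_ge_zero[of "v k"]] by linarith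
  have L0: "0 \<le> L" using Gx[of 0] norm_ge_zero order_trans by blast
  \<comment> \<open>A unit step beyond \<open>x k + v k\<close> along the slope at
    \<open>z k\<close> raises that tangent by \<open>norm (G (z k))\<close>, while
    \<open>diff\<close> caps the supremum there.\<close>
  have Gz: "norm (G (z k)) \<le> 2 * L" for k
  proof -
    let ?u = "sgn (G (z k))"
    have "norm (v k + ?u) \<le> 2" using v1[of k] nsgn[of "G (z k)"] by (intro norm_triangle_le) linarith
    then have "M (x k + (v k + ?u)) - f (x k) \<le> L" unfolding L_def by (rule diff)
    moreover have "f (z k) + G (z k) \<bullet> (x k + (v k + ?u) - z k) \<le> M (x k + (v k + ?u))"
      by (rule tangent_sup_upper[OF z])
    moreover have "G (z k) \<bullet> (x k + (v k + ?u) - z k) = G (z k) \<bullet> (x k + v k - z k) + norm (G (z k))"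
      using sgn[of "G (z k)"] by (simp add: inner_add_right inner_diff_right)
    moreover have "L * norm (v k) \<le> L" using L0 v1[of k] by (simp add: mult_left_le)
    moreover have "0 \<le> e * norm (v k)" using e by simp
    ultimately show ?thesis using zv[of k] Gxv[of k] by linarith
  qed
  let ?\<delta> = "\<lambda>k. f (x k) - f (z k) - G (z k) \<bullet> (x k - z k)"
  have \<delta>0: "0 \<le> ?\<delta> k" for k using sub[OF x(1)[of k] z[of k]] by simp
  have \<delta>: "?\<delta> k + e * norm (v k) < G (z k) \<bullet> v k - G (x k) \<bullet> v k" for k
    using zv[of k] by (simp add: inner_diff_right inner_add_right)
  have \<delta>_le: "?\<delta> k \<le> 3 * L * (1 / (real k + 1))" for k
  proof -
    have "\<bar>G (z k) \<bullet> v k\<bar> \<le> 2 * L * norm (v k)"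
      using Cauchy_Schwarz_ineq2[of "G (z k)" "v k"] mult_right_mono[OF Gz[of k] norm_ge_zero[of "v k"]] by linarith
    moreover have "0 \<le> e * norm (v k)" using e by simp
    ultimately have "?\<delta> k \<le> 3 * L * norm (v k)" using \<delta>[of k] Gxv[of k] by linarith
    also have "\<dots> \<le> 3 * L * (1 / (real k + 1))" using v[of k] L0 by (intro mult_left_mono) auto
    finally show ?thesis .
  qed
  have lim0: "(\<lambda>k. 3 * L * (1 / (real k + 1))) \<longlonglongrightarrow> 0"
    using LIMSEQ_inverse_real_of_nat by (intro tendsto_mult_right_zero) (simp add: inverse_eq_divide add.commute)
  have "?\<delta> \<longlonglongrightarrow> 0"
    by (rule tendsto_sandwich[OF always_eventually always_eventually tendsto_const lim0])
      (intro allI \<delta>0 \<delta>_le)+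
  moreover have "bounded (range (\<lambda>k. ?P (x k)))" using x(2) by (auto simp: bounded_iff)
  moreover have "bounded (range (\<lambda>k. G (z k)))" using Gz by (auto simp: bounded_iff)
  ultimately have "(\<lambda>k. norm (G (x k) - G (z k))) \<longlonglongrightarrow> 0" using x(1) z by (intro lim)
  then have "eventually (\<lambda>k. norm (G (x k) - G (z k)) < e) sequentially" using e by (rule order_tendstoD)
  then obtain k where k: "norm (G (x k) - G (z k)) < e" unfolding eventually_sequentially by blast
  have "e * norm (v k) < (G (z k) - G (x k)) \<bullet> v k" using \<delta>[of k] \<delta>0[of k] by (simp add: inner_diff_left)
  also have "\<dots> \<le> norm (G (z k) - G (x k)) * norm (v k)" by (rule norm_cauchy_schwarz)
  also have "\<dots> \<le> e * norm (v k)" using k by (intro mult_right_mono) (auto simp: norm_minus_commute)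
  finally show False by simp
qed

text \<open>Growth along \<open>Y\<close> comes from finitely many tangents, growth across
  \<open>Y\<close> from the squared distance. The auxiliary \<open>h\<close> is continuous,
  positively homogeneous and positive away from 0, so compactness of the sphere yields a linear
  lower bound.\<close>

lemma tangent_sup_coercive:
  assumes Y: "Y = span {G x - G y | x y. x \<in> E \<and> y \<in> E}"
  obtains b c C where "\<And>y. y \<in> E \<Longrightarrow> G y - b \<in> Y" "c > 0"
    "\<And>p. c * norm p - C \<le> M p - b \<bullet> p + (norm (p - orth_proj Y p))\<^sup>2"
proof -
  have sY: "subspace Y" by (simp add: Y)
  let ?S = "{G x - G y | x y. x \<in> E \<and> y \<in> E}"
  obtain T where T: "T \<subseteq> ?S" "independent T" "?S \<subseteq> span T"
    using maximal_independent_subset[of ?S] by blast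
  have finT: "finite T" using T(2) by (rule independent_imp_finite)
  have YT: "Y \<subseteq> span T" unfolding Y using T(3) by (simp add: span_minimal)
  have "\<forall>t\<in>T. \<exists>x y. x \<in> E \<and> y \<in> E \<and> t = G x - G y" using T(1) by blast
  then obtain X Z where XZ: "\<And>t. t \<in> T \<Longrightarrow> X t \<in> E \<and> Z t \<in> E \<and> t = G (X t) - G (Z t)" by metis
  obtain y0 where y0: "y0 \<in> E" using E by blast
  \<comment> \<open>\<open>y0\<close> keeps \<open>Q\<close> nonempty when all slopes agree and
    \<open>T\<close> is empty.\<close>
  define Q where "Q = insert y0 (X ` T \<union> Z ` T)"
  have Q: "finite Q" "Q \<subseteq> E" "Q \<noteq> {}" using finT XZ y0 by (auto simp: Q_def)
  define N where "N = real (card Q)"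
  have N: "N \<ge> 1" using Q by (simp add: N_def Suc_leI card_gt_0_iff)
  \<comment> \<open>After subtracting the mean \<open>b\<close> the slopes at \<open>Q\<close> add up to zero and span \<open>Y\<close>, so at each nonzero point of \<open>Y\<close>
    one of them has a positive inner product.\<close>
  define b where "b = (1 / N) *\<^sub>R (\<Sum>q\<in>Q. G q)"
  have Nb: "(\<Sum>q\<in>Q. G q - b) = 0" using N by (simp add: sum_subtractf b_def N_def sum_constant_scaleR)
  have bY: "G y - b \<in> Y" if "y \<in> E" for y
  proof -
    have "(1 / N) *\<^sub>R (\<Sum>q\<in>Q. G y - G q) \<in> Y"
      using Q that by (intro subspace_scale[OF sY] subspace_sum[OF sY]) (auto simp: Y intro!: span_base)
    moreover have "(1 / N) *\<^sub>R (\<Sum>q\<in>Q. G y - G q) = G y - b"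
      using N by (simp add: sum_subtractf b_def N_def sum_constant_scaleR scaleR_diff_right)
    ultimately show ?thesis by simp
  qed
  define h where "h p = (\<Sum>q\<in>Q. max 0 ((G q - b) \<bullet> p)) + norm (p - orth_proj Y p)" for p
  have h0: "h p > 0" if "p \<noteq> 0" for p
  proof (rule ccontr)
    assume "\<not> h p > 0"
    moreover have s0: "0 \<le> (\<Sum>q\<in>Q. max 0 ((G q - b) \<bullet> p))" by (intro sum_nonneg) auto
    ultimately have "(\<Sum>q\<in>Q. max 0 ((G q - b) \<bullet> p)) = 0" and "norm (p - orth_proj Y p) = 0"
      using norm_ge_zero[of "p - orth_proj Y p"] unfolding h_def by linarith+
    then have le: "(G q - b) \<bullet> p \<le> 0" if "q \<in> Q" for q
      using that Q(1) by (subst (asm) sum_nonneg_eq_0_iff) (auto simp: max_def split: if_splits)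
    have "(\<Sum>q\<in>Q. - ((G q - b) \<bullet> p)) = 0"
      using Nb by (simp add: sum_negf flip: inner_sum_left)
    then have eq: "(G q - b) \<bullet> p = 0" if "q \<in> Q" for q
      using that Q(1) le by (subst (asm) sum_nonneg_eq_0_iff) auto
    have "t \<bullet> p = 0" if "t \<in> T" for t
    proof -
      have "X t \<in> Q" "Z t \<in> Q" using that by (auto simp: Q_def)
      then have "(G (X t) - G (Z t)) \<bullet> p = 0" using eq[of "X t"] eq[of "Z t"] by (simp add: inner_diff_left)
      then show ?thesis using XZ[OF that] by simp
    qed
    moreover have "p \<in> Y" using \<open>norm (p - orth_proj Y p) = 0\<close> orth_proj_mem[OF sY, of p] by simp
    ultimately have "orthogonal p p"
      using YT by (intro orthogonal_to_span[of p T p]) (auto simp: orthogonal_def inner_commute)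
    then show False using that by (simp add: orthogonal_def)
  qed
  have lin: "linear (orth_proj Y)" by (rule linear_orth_proj[OF sY])
  have "continuous_on (sphere 0 1) h"
    unfolding h_def using linear_continuous_on[OF linear_conv_bounded_linear[THEN iffD1, OF lin]]
    by (intro continuous_intros) auto
  then obtain p0 where p0: "p0 \<in> sphere (0::'a) 1" "\<And>p. p \<in> sphere 0 1 \<Longrightarrow> h p0 \<le> h p"
    using continuous_attains_inf[of "sphere (0::'a) 1" h] by auto
  have hp0: "h p0 > 0" using p0(1) by (intro h0) auto
  have hom: "h (r *\<^sub>R p) = r * h p" if "r \<ge> 0" for r p
  proof -
    have "norm (r *\<^sub>R p - orth_proj Y (r *\<^sub>R p)) = r * norm (p - orth_proj Y p)"
      using that linear_scale[OF lin, of r p] by (simp flip: scaleR_diff_right)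
    moreover have "max 0 ((G q - b) \<bullet> (r *\<^sub>R p)) = r * max 0 ((G q - b) \<bullet> p)" for q
      using that by (simp add: max_mult_distrib_left)
    ultimately show ?thesis by (simp add: h_def distrib_left sum_distrib_left)
  qed
  have hlow: "h p0 * norm p \<le> h p" for p
  proof (cases "p = 0")
    case False
    then have "h p0 \<le> h (sgn p)" by (intro p0(2)) (simp add: norm_sgn)
    then have "norm p * h p0 \<le> norm p * h (sgn p)" by (intro mult_left_mono) auto
    also have "\<dots> = h (norm p *\<^sub>R sgn p)" by (rule hom[symmetric]) simp
    also have "norm p *\<^sub>R sgn p = p" using False by (simp add: sgn_div_norm)
    finally show ?thesis by (simp add: mult.commute)
  qed (use hom[of 0 0] in simp)
  define B where "B = (\<Sum>q\<in>Q. \<bar>f q - G q \<bullet> q\<bar>)"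
  have B: "\<bar>f q - G q \<bullet> q\<bar> \<le> B" if "q \<in> Q" for q
    unfolding B_def using Q(1) that by (intro member_le_sum) auto
  have up: "(G q - b) \<bullet> p \<le> M p - b \<bullet> p + B" if "q \<in> Q" for p q
    using tangent_sup_upper[of q p] Q(2) that B[OF that] by (auto simp: inner_diff_left inner_diff_right)
  \<comment> \<open>The bounds \<open>up\<close> are summed over \<open>Q\<close>, where the tilted
    slopes cancel.\<close>
  have pos: "0 \<le> M p - b \<bullet> p + B" for p
  proof -
    have "(\<Sum>q\<in>Q. (G q - b) \<bullet> p) \<le> (\<Sum>q\<in>Q. M p - b \<bullet> p + B)" by (intro sum_mono up)
    moreover have "(\<Sum>q\<in>Q. (G q - b) \<bullet> p) = 0" using Nb by (simp flip: inner_sum_left)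
    ultimately have "0 \<le> N * (M p - b \<bullet> p + B)" by (simp add: N_def)
    then show ?thesis using N by (simp add: zero_le_mult_iff)
  qed
  have "h p0 / N * norm p - (B + 1) \<le> M p - b \<bullet> p + (norm (p - orth_proj Y p))\<^sup>2" for p
  proof -
    let ?n = "norm (p - orth_proj Y p)"
    have "(\<Sum>q\<in>Q. max 0 ((G q - b) \<bullet> p)) \<le> (\<Sum>q\<in>Q. M p - b \<bullet> p + B)"
      using up pos by (intro sum_mono) auto
    then have "h p \<le> N * (M p - b \<bullet> p + B) + ?n" by (simp add: h_def N_def)
    also have "\<dots> \<le> N * (M p - b \<bullet> p + B) + N * ?n"
      using N mult_right_mono[of 1 N ?n] by simp
    finally have "h p0 * norm p \<le> N * (M p - b \<bullet> p + B + ?n)" using hlow[of p] by (simp add: distrib_left)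
    then have "h p0 / N * norm p \<le> M p - b \<bullet> p + B + ?n" using N by (simp add: field_simps)
    \<comment> \<open>The distance is traded for its square at the cost of a constant, the 1 in
      \<open>B + 1\<close>.\<close>
    moreover have "?n \<le> ?n\<^sup>2 + 1"
      using sum_squares_bound[of 1 ?n] by (simp add: power2_eq_square) (smt (verit) norm_ge_zero mult_nonneg_nonneg)
    ultimately show ?thesis by linarith
  qed
  moreover have "h p0 / N > 0" using hp0 N by simp
  ultimately show thesis using bY by (intro that)
qed

section \<open>Reduction of the general case to the coercive one\<close>

lemma C1_convex_extension:
  assumes P_def: "P = orth_proj (span {G x - G y | x y. x \<in> E \<and> y \<in> E})"
    and lim: "\<And>x z :: nat \<Rightarrow> 'a.
           (\<And>k. x k \<in> E) \<Longrightarrow> (\<And>k. z k \<in> E) \<Longrightarrow>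
           bounded (range (\<lambda>k. P (x k))) \<Longrightarrow>
           bounded (range (\<lambda>k. G (z k))) \<Longrightarrow>
           (\<lambda>k. f (x k) - f (z k) - G (z k) \<bullet> (x k - z k)) \<longlonglongrightarrow> 0 \<Longrightarrow>
           (\<lambda>k. norm (G (x k) - G (z k))) \<longlonglongrightarrow> 0"
  shows "\<exists>F :: 'a \<Rightarrow> real. convex_on UNIV F \<and> class_C1 F \<and> (\<forall>x\<in>E. F x = f x \<and> GDERIV F x :> G x)"
proof -
  define Y where "Y = span {G x - G y | x y. x \<in> E \<and> y \<in> E}"
  have Y: "subspace Y" by (simp add: Y_def)
  have P: "P = orth_proj Y" using P_def by (simp add: Y_def)
  have GY: "G x - G y \<in> Y" if "x \<in> E" "y \<in> E" for x y
    unfolding Y_def using that by (intro span_base) blast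
  have lin: "linear P" unfolding P by (rule linear_orth_proj[OF Y])
  have PP: "P (P x) = P x" for x
    unfolding P by (rule orth_proj_eqI[OF Y orth_proj_mem[OF Y]]) simp
  obtain b c C where b: "\<And>y. y \<in> E \<Longrightarrow> G y - b \<in> Y" and c: "c > 0"
    and coercive: "\<And>p. c * norm p - C \<le> M p - b \<bullet> p + (norm (p - orth_proj Y p))\<^sup>2"
    using tangent_sup_coercive[OF Y_def] by blast
  define m where "m p = M p - b \<bullet> p + (norm (p - P p))\<^sup>2" for p
  \<comment> \<open>The first two terms of \<open>m\<close> depend on the projection only, so
    \<open>P x + v\<close> may be replaced by \<open>x + v\<close>; in the distance term the
    contribution of \<open>P x\<close> cancels.\<close>
  have mP: "m (P x + v) = M (x + v) - b \<bullet> (x + v) + (norm (v - P v))\<^sup>2" for x v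
  proof -
    have "orth_proj Y (P x + v) = orth_proj Y (x + v)"
      unfolding P[symmetric] by (simp add: linear_add[OF lin] PP)
    then have "M (P x + v) - b \<bullet> (P x + v) = M (x + v) - b \<bullet> (x + v)"
      by (intro tangent_sup_tilted_cong[OF Y b])
    then show ?thesis by (simp add: m_def linear_add[OF lin] PP)
  qed
  have mPx: "m (P x) = f x - b \<bullet> x" if "x \<in> E" for x
    using mP[of x 0] tangent_sup_eq[OF that] by (simp add: linear_0[OF lin])
  have "convex_on UNIV (\<lambda>p. M p + (- (b \<bullet> p)) + (norm (p - P p))\<^sup>2)"
  proof (intro convex_on_add convex_on_tangent_sup convex_on_norm_sq_linear)
    show "convex_on UNIV (\<lambda>p. - (b \<bullet> p))"
      by (rule convex_onI) (auto simp: algebra_simps inner_add_right)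
    show "linear (\<lambda>p. p - P p)" using lin by (intro linear_compose_sub linear_ident)
  qed
  then have convex: "convex_on UNIV m" unfolding m_def by simp
  have msub: "m (P x) + (G x - b) \<bullet> (p - P x) \<le> m p" if "x \<in> E" for x p
  proof -
    \<comment> \<open>The tilted slope is orthogonal to \<open>x - P x\<close>, so the tangent based
      at \<open>x\<close> may be based at \<open>P x\<close>.\<close>
    have "(x - P x) \<bullet> (G x - b) = 0" unfolding P by (rule orth_proj_orthogonal[OF Y b[OF that]])
    then have "(G x - b) \<bullet> (p - P x) = (G x - b) \<bullet> (p - x)"
      by (simp add: algebra_simps inner_commute)
    then have "m (P x) + (G x - b) \<bullet> (p - P x) = f x + G x \<bullet> (p - x) - b \<bullet> p"
      by (simp add: mPx[OF that] inner_diff_left inner_diff_right)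
    also have "\<dots> \<le> M p - b \<bullet> p + (norm (p - P p))\<^sup>2" using tangent_sup_upper[OF that, of p] by (simp add: add_increasing2)
    finally show ?thesis by (simp add: m_def)
  qed
  have munif: "\<exists>d>0. \<forall>x\<in>E. \<forall>v. norm (P x) \<le> R \<longrightarrow> norm v \<le> d \<longrightarrow>
      m (P x + v) \<le> m (P x) + (G x - b) \<bullet> v + e * norm v" if e: "e > 0" for R e
  proof -
    obtain d where d: "d > 0" "\<And>x v. x \<in> E \<Longrightarrow> norm (P x) \<le> R \<Longrightarrow> norm v \<le> d \<Longrightarrow>
        M (x + v) \<le> f x + G x \<bullet> v + e / 2 * norm v"
      using tangent_sup_uniformly_differentiable[OF Y GY lim[unfolded P] half_gt_zero[OF e], of R]
      unfolding P by blast
    have "m (P x + v) \<le> m (P x) + (G x - b) \<bullet> v + e * norm v"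
      \<comment> \<open>\<open>d\<close> serves the supremum and \<open>e / 2\<close> the squared
        distance; each contributes half of the error.\<close>
      if x: "x \<in> E" "norm (P x) \<le> R" and v: "norm v \<le> min d (e / 2)" for x v
    proof -
      have "norm (v - P v) \<le> norm v" unfolding P by (rule norm_orth_proj_le(2)[OF Y])
      then have "(norm (v - P v))\<^sup>2 \<le> norm v * norm v" by (simp add: power2_eq_square mult_mono)
      also have "\<dots> \<le> e / 2 * norm v" using v by (intro mult_right_mono) auto
      finally show ?thesis using d(2)[OF x, of v] v
        by (simp add: mP mPx[OF x(1)] inner_diff_left inner_add_right)
    qed
    then show ?thesis using d(1) e by (intro exI[of _ "min d (e / 2)"]) auto
  qed
  obtain F where F: "convex_on UNIV F" "class_C1 F" "\<And>x. x \<in> E \<Longrightarrow> F (P x) = m (P x)"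
      "\<And>x. x \<in> E \<Longrightarrow> GDERIV F (P x) :> G x - b"
    using convex_C1_extension[OF E convex c _ msub munif, of C] coercive unfolding m_def P by blast
  have GD: "GDERIV (\<lambda>x. F (P x) + b \<bullet> x) x :> P D + b" if "GDERIV F (P x) :> D" for x D
  proof -
    have "GDERIV (\<lambda>x. b \<bullet> x) x :> b"
      unfolding gderiv_def by (auto intro!: derivative_eq_intros simp: inner_commute)
    then show ?thesis using GDERIV_compose_orth_proj[OF Y] that unfolding P by (intro GDERIV_add) auto
  qed
  show ?thesis
  proof (intro exI[of _ "\<lambda>x. F (P x) + b \<bullet> x"] conjI ballI)
    show "convex_on UNIV (\<lambda>x. F (P x) + b \<bullet> x)"
    proof (intro convex_on_add)
      show "convex_on UNIV (\<lambda>x. F (P x))"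
        using convex_onD[OF F(1)] by (intro convex_onI) (auto simp: linear_add[OF lin] linear_scale[OF lin])
      show "convex_on UNIV (\<lambda>x. b \<bullet> x)"
        by (rule convex_onI) (auto simp: algebra_simps inner_add_right)
    qed
    obtain D where D: "\<And>x. GDERIV F x :> D x" "continuous_on UNIV D"
      using F(2) unfolding class_C1_def by blast
    have cP: "continuous_on S P" for S using lin by (rule linear_continuous_on[OF linear_conv_bounded_linear[THEN iffD1]])
    have "continuous_on UNIV (\<lambda>x. P (D (P x)) + b)"
      by (intro continuous_intros continuous_on_compose2[OF cP] continuous_on_compose2[OF D(2)] cP) auto
    then show "class_C1 (\<lambda>x. F (P x) + b \<bullet> x)"
      unfolding class_C1_def using GD[OF D(1)] by (intro exI[of _ "\<lambda>x. P (D (P x)) + b"]) simp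
    fix x assume x: "x \<in> E"
    show "F (P x) + b \<bullet> x = f x" using F(3)[OF x] mPx[OF x] by simp
    \<comment> \<open>The composite has gradient \<open>P (G x - b) + b\<close>, which is
      \<open>G x\<close> because \<open>P\<close> fixes the elements of \<open>Y\<close>.\<close>
    have "P (G x - b) = G x - b" unfolding P by (rule orth_proj_eqI[OF Y b[OF x]]) simp
    then show "GDERIV (\<lambda>x. F (P x) + b \<bullet> x) x :> G x" using GD[OF F(4)[OF x]] by simp
  qed
qed

end

theorem corollary1p6:
  fixes E :: "(real ^ 'n) set"
    and f :: "real ^ 'n \<Rightarrow> real"
    and G :: "real ^ 'n \<Rightarrow> real ^ 'n"
    and P :: "real ^ 'n \<Rightarrow> real ^ 'n"
  assumes "continuous_on E G"
    and "\<And>x y. x \<in> E \<Longrightarrow> y \<in> E \<Longrightarrow> f x \<ge> f y + G y \<bullet> (x - y)"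
    and "\<And>x :: nat \<Rightarrow> real ^ 'n.
           (\<And>k. x k \<in> E) \<Longrightarrow>
           filterlim (\<lambda>k. norm (G (x k))) at_top sequentially \<Longrightarrow>
           filterlim (\<lambda>k. (G (x k) \<bullet> x k - f (x k)) / norm (G (x k))) at_top sequentially"
    and "P = orth_proj (span {G x - G y | x y. x \<in> E \<and> y \<in> E})"
    and "\<And>x z :: nat \<Rightarrow> real ^ 'n.
           (\<And>k. x k \<in> E) \<Longrightarrow> (\<And>k. z k \<in> E) \<Longrightarrow>
           bounded (range (\<lambda>k. P (x k))) \<Longrightarrow>
           bounded (range (\<lambda>k. G (z k))) \<Longrightarrow>
           (\<lambda>k. f (x k) - f (z k) - G (z k) \<bullet> (x k - z k)) \<longlonglongrightarrow> 0 \<Longrightarrow>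
           (\<lambda>k. norm (G (x k) - G (z k))) \<longlonglongrightarrow> 0"
  shows "\<exists>F :: real ^ 'n \<Rightarrow> real.
           convex_on UNIV F \<and> class_C1 F \<and>
           (\<forall>x\<in>E. F x = f x \<and> GDERIV F x :> G x)"
proof (cases "E = {}")
  \<comment> \<open>A supremum over the empty set carries no information, so the zero function is
    given directly.\<close>
  case True
  have "class_C1 (\<lambda>_::real ^ 'n. 0 :: real)"
    unfolding class_C1_def by (intro exI[of _ "\<lambda>_. 0"]) (auto simp: GDERIV_const)
  then show ?thesis using True by (intro exI[of _ "\<lambda>_. 0"]) (auto simp: convex_on_const)
next
  case False
  show ?thesis
  proof (rule C1_convex_extension[OF False _ _ assms(4)])
    show "bdd_above ((\<lambda>y. f y + G y \<bullet> (p - y)) ` E)" for p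
      by (rule bdd_above_tangents) (fact assms(2,3))+
  qed (fact assms(2,5))+
qed

end
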